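(* Let $\zeta\in\mathcal N=\omega^\omega$. Let $G$ be a Polish group and $X$ a Polish $G$-space, both presented recursively in $\zeta$, and assume that the group operations of $G$ (multiplication and inversion) and the action $G\times X\to X$ are hyperarithmetic in $\zeta$. Let $x,y\in X$ be such that $x$ is hyperarithmetic in $\zeta$ and $x,y$ are in the same $G$-invariant subsets of $X$ that are hyperarithmetic in $\zeta$ (i.e. for every $G$-invariant $B\subseteq X$ hyperarithmetic in $\zeta$, $x\in B\iff y\in B$). Then for every ordinal $\alpha$ with $1\le\alpha\le\omega_1^{CK}(\zeta)$, $x$ and $y$ are in the same $G$-invariant Borel subsets of $X$ of Borel rank $\alpha$.
   Context: A Polish space is a separable completely metrizable topological space; a Polish $G$-space is a Polish space $X$ with a continuous action of a Polish group $G$. A set $B\subseteq X$ is invariant if $gB=B$ for all $g\in G$. Presentations. A Polish space with compatible complete metric $d$ is presented recursively in $\zeta$ if it is equipped with a dense sequence $\{r_i:i\in\omega\}$ such that the relations (in $i,j,k,m$) $d(r_i,r_j)\le\frac{m}{k+1}$ and $d(r_i,r_j)<\frac{m}{k+1}$ are recursive in $\zeta$. The canonical basis consists of the (nonempty) open balls $\{x:d(x,r_i)<\frac{m}{k+1}\}$, $m\ge1$, enumerated effectively; $\{U_n:n\in\omega\}$ is such an enumeration for $X$ and $\{V_n:n\in\omega\}$ one for $G$, where additionally $V_0=G$. The spaces $\omega$ and $\mathcal N$ have their usual recursive presentations, and finite products have the product presentations. Effective pointclasses relative to $\zeta$. For a space $Z$ presented recursively in $\zeta$ with basis $\{U^Z_n\}$,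 a set $A\subseteq Z$ is $\Sigma^0_1(\zeta)$ (semirecursive in $\zeta$) if $A=\bigcup_{n\in W}U^Z_n$ for some $W\subseteq\omega$ recursively enumerable in $\zeta$; $\Pi^0_1(\zeta)$ sets are the complements; $\Sigma^1_1(\zeta)$ subsets of $Z$ are projections along $\mathcal N$ of $\Pi^0_1(\zeta)$ subsets of $Z\times\mathcal N$; $\Pi^1_1(\zeta)$ sets are their complements. A set is hyperarithmetic in $\zeta$ if it is in $\Delta^1_1(\zeta)=\Sigma^1_1(\zeta)\cap\Pi^1_1(\zeta)$. A function $f:Y\to Z$ is hyperarithmetic in $\zeta$ if $\{(y,n):f(y)\in U^Z_n\}$ is hyperarithmetic in $\zeta$. A point $x\in X$ is hyperarithmetic in $\zeta$ if $\{n\in\omega:x\in U_n\}$ is hyperarithmetic in $\zeta$. $\omega_1^{CK}(\zeta)$ is the first ordinal not recursive in $\zeta$. Borel rank refers to the usual (boldface) Borel hierarchy $\mathbf\Sigma^0_\alpha,\mathbf\Pi^0_\alpha$, $1\le\alpha<\omega_1$: sets of Borel rank $\alpha$ are those in $\mathbf\Sigma^0_\alpha\cup\mathbf\Pi^0_\alpha$. *)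

theory Defs
  imports "HOL-Analysis.Analysis" "HOL-Library.Nat_Bijection"
begin

section \<open>Recursion relative to an oracle\<close>

text \<open>
  \<open>rec_fun \<zeta> k f\<close>: the restriction of \<open>f\<close> to lists of length \<open>k\<close> is a \<open>k\<close>-ary total
  function that is recursive in \<open>\<zeta>\<close>. Only the values on lists of length \<open>k\<close> matter (rule \<open>cong\<close>).
  Minimization is applied to regular functions only, so all functions are total.
\<close>

inductive rec_fun :: "(nat \<Rightarrow> nat) \<Rightarrow> nat \<Rightarrow> (nat list \<Rightarrow> nat) \<Rightarrow> bool" for \<zeta> :: "nat \<Rightarrow> nat" where
  zero: "rec_fun \<zeta> k (\<lambda>xs. 0)"
| succ: "rec_fun \<zeta> 1 (\<lambda>xs. Suc (xs ! 0))"
| proj: "i < k \<Longrightarrow> rec_fun \<zeta> k (\<lambda>xs. xs ! i)"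
| oracle_fun: "rec_fun \<zeta> 1 (\<lambda>xs. \<zeta> (xs ! 0))"
| comp: "rec_fun \<zeta> (length gs) f \<Longrightarrow> \<forall>g\<in>set gs. rec_fun \<zeta> k g
    \<Longrightarrow> rec_fun \<zeta> k (\<lambda>xs. f (map (\<lambda>g. g xs) gs))"
| prim_rec: "rec_fun \<zeta> k f \<Longrightarrow> rec_fun \<zeta> (k + 2) g
    \<Longrightarrow> rec_fun \<zeta> (Suc k)
          (\<lambda>xs. rec_nat (f (tl xs)) (\<lambda>n r. g (n # r # tl xs)) (hd xs))"
| minim: "rec_fun \<zeta> (Suc k) f \<Longrightarrow> \<forall>xs. length xs = k \<longrightarrow> (\<exists>n. f (n # xs) = 0)
    \<Longrightarrow> rec_fun \<zeta> k (\<lambda>xs. LEAST n. f (n # xs) = 0)"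
| cong: "rec_fun \<zeta> k f \<Longrightarrow> \<forall>xs. length xs = k \<longrightarrow> f xs = g xs \<Longrightarrow> rec_fun \<zeta> k g"

definition rec_rel :: "(nat \<Rightarrow> nat) \<Rightarrow> nat \<Rightarrow> (nat list \<Rightarrow> bool) \<Rightarrow> bool" where
  "rec_rel \<zeta> k R \<longleftrightarrow> rec_fun \<zeta> k (\<lambda>xs. if R xs then 1 else 0)"

definition re_in :: "(nat \<Rightarrow> nat) \<Rightarrow> nat set \<Rightarrow> bool" where
  "re_in \<zeta> W \<longleftrightarrow> (\<exists>R. rec_rel \<zeta> 2 R \<and> W = {n. \<exists>m. R [n, m]})"


section \<open>Recursively presented Polish spaces\<close>

datatype 'a presentation = Presentation (pdist: "'a \<Rightarrow> 'a \<Rightarrow> real") (pseq: "nat \<Rightarrow> 'a")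

text \<open>
  The first four conjuncts say that the ambient topology of the type is Polish, with
  \<open>pdist P\<close> a compatible complete metric and \<open>pseq P\<close> a dense sequence.
\<close>

definition presented_in :: "(nat \<Rightarrow> nat) \<Rightarrow> 'a::topological_space presentation \<Rightarrow> bool" where
  "presented_in \<zeta> P \<longleftrightarrow>
     Metric_space UNIV (pdist P) \<and>
     Metric_space.mtopology UNIV (pdist P) = euclidean \<and>
     Metric_space.mcomplete UNIV (pdist P) \<and>
     closure (range (pseq P)) = UNIV \<and>
     rec_rel \<zeta> 4 (\<lambda>xs. pdist P (pseq P (xs ! 0)) (pseq P (xs ! 1))
                          \<le> real (xs ! 3) / (real (xs ! 2) + 1)) \<and>
     rec_rel \<zeta> 4 (\<lambda>xs. pdist P (pseq P (xs ! 0)) (pseq P (xs ! 1))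
                          < real (xs ! 3) / (real (xs ! 2) + 1))"

text \<open>The number \<open>\<langle>i, \<langle>m, k\<rangle>\<rangle>\<close> codes the ball around \<open>r\<^sub>i\<close> of radius \<open>(m + 1) / (k + 1)\<close>.\<close>

definition basic_open :: "'a presentation \<Rightarrow> nat \<Rightarrow> 'a set" where
  "basic_open P n =
     (case prod_decode n of (i, c) \<Rightarrow> case prod_decode c of (m, k) \<Rightarrow>
        {x. pdist P x (pseq P i) < (real m + 1) / (real k + 1)})"

definition nat_pres :: "nat presentation" where
  "nat_pres = Presentation dist (\<lambda>i. i)"

text \<open>The dense sequence of Baire space runs through the eventually zero sequences.\<close>

definition baire_pres :: "(nat \<Rightarrow> nat) presentation" where
  "baire_pres = Presentation
     (\<lambda>f g. if f = g then 0 else 1 / (real (LEAST n. f n \<noteq> g n) + 1))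
     (\<lambda>i n. if n < length (list_decode i) then list_decode i ! n else 0)"

text \<open>
  Products carry the maximum metric. The type class metric on pairs is the Euclidean one, for
  which the two relations in \<open>presented_in\<close> need not be recursive.
\<close>

definition prod_pres :: "'a presentation \<Rightarrow> 'b presentation \<Rightarrow> ('a \<times> 'b) presentation" where
  "prod_pres P Q = Presentation
     (\<lambda>(x, y) (x', y'). max (pdist P x x') (pdist Q y y'))
     (\<lambda>n. case prod_decode n of (i, j) \<Rightarrow> (pseq P i, pseq Q j))"


section \<open>Effective pointclasses\<close>

definition Sigma01 :: "(nat \<Rightarrow> nat) \<Rightarrow> 'a presentation \<Rightarrow> 'a set \<Rightarrow> bool" where
  "Sigma01 \<zeta> P A \<longleftrightarrow> (\<exists>W. re_in \<zeta> W \<and> A = (\<Union>n\<in>W. basic_open P n))"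

definition Pi01 :: "(nat \<Rightarrow> nat) \<Rightarrow> 'a presentation \<Rightarrow> 'a set \<Rightarrow> bool" where
  "Pi01 \<zeta> P A \<longleftrightarrow> Sigma01 \<zeta> P (- A)"

definition Sigma11 :: "(nat \<Rightarrow> nat) \<Rightarrow> 'a presentation \<Rightarrow> 'a set \<Rightarrow> bool" where
  "Sigma11 \<zeta> P A \<longleftrightarrow> (\<exists>C. Pi01 \<zeta> (prod_pres P baire_pres) C \<and> A = fst ` C)"

definition Pi11 :: "(nat \<Rightarrow> nat) \<Rightarrow> 'a presentation \<Rightarrow> 'a set \<Rightarrow> bool" where
  "Pi11 \<zeta> P A \<longleftrightarrow> Sigma11 \<zeta> P (- A)"

definition hyp_set :: "(nat \<Rightarrow> nat) \<Rightarrow> 'a presentation \<Rightarrow> 'a set \<Rightarrow> bool" where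
  "hyp_set \<zeta> P A \<longleftrightarrow> Sigma11 \<zeta> P A \<and> Pi11 \<zeta> P A"

definition hyp_fun :: "(nat \<Rightarrow> nat) \<Rightarrow> 'a presentation \<Rightarrow> 'b presentation \<Rightarrow> ('a \<Rightarrow> 'b) \<Rightarrow> bool" where
  "hyp_fun \<zeta> P Q f \<longleftrightarrow> hyp_set \<zeta> (prod_pres P nat_pres) {(y, n). f y \<in> basic_open Q n}"

definition hyp_point :: "(nat \<Rightarrow> nat) \<Rightarrow> 'a presentation \<Rightarrow> 'a \<Rightarrow> bool" where
  "hyp_point \<zeta> P x \<longleftrightarrow> hyp_set \<zeta> nat_pres {n. x \<in> basic_open P n}"


section \<open>Continuous actions\<close>

text \<open>
  The (not necessarily abelian) group is written additively, following the library class
  \<^class>\<open>topological_group_add\<close>.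
\<close>

definition continuous_action ::
    "('g::topological_group_add \<Rightarrow> 'x::topological_space \<Rightarrow> 'x) \<Rightarrow> bool" where
  "continuous_action act \<longleftrightarrow>
     (\<forall>x. act 0 x = x) \<and> (\<forall>g h x. act (g + h) x = act g (act h x)) \<and>
     continuous_on UNIV (\<lambda>(g, x). act g x)"

definition invariant :: "('g \<Rightarrow> 'x \<Rightarrow> 'x) \<Rightarrow> 'x set \<Rightarrow> bool" where
  "invariant act B \<longleftrightarrow> (\<forall>g. act g ` B = B)"


section \<open>Countable ordinals and the Borel hierarchy\<close>

text \<open>
  A countable ordinal is represented by any well-order of that order type whose field is a set of
  natural numbers; ordinals are compared by \<open>ordLess\<close>, \<open>ordLeq\<close> and \<open>ordIso\<close>.
\<close>

definition recursive_ordinal :: "(nat \<Rightarrow> nat) \<Rightarrow> (nat \<times> nat) set \<Rightarrow> bool" where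
  "recursive_ordinal \<zeta> \<alpha> \<longleftrightarrow>
     (\<exists>r::(nat \<times> nat) set. (r, \<alpha>) \<in> ordIso \<and> rec_rel \<zeta> 2 (\<lambda>xs. (xs ! 0, xs ! 1) \<in> r))"

text \<open>\<open>is_omega1CK \<zeta> w\<close>: the order type of \<open>w\<close> is the first ordinal not recursive in \<open>\<zeta>\<close>.\<close>

definition is_omega1CK :: "(nat \<Rightarrow> nat) \<Rightarrow> (nat \<times> nat) set \<Rightarrow> bool" where
  "is_omega1CK \<zeta> w \<longleftrightarrow>
     Well_order w \<and> \<not> recursive_ordinal \<zeta> w \<and>
     (\<forall>\<alpha>::(nat \<times> nat) set. (\<alpha>, w) \<in> ordLess \<longrightarrow> recursive_ordinal \<zeta> \<alpha>)"

text \<open>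
  Boldface classes for ordinals \<open>\<alpha> \<ge> 1\<close>. The well-orders of type 1 are the relations \<open>{(a, a)}\<close>.
  For these the second rule does not apply, since its premises require some \<open>1 \<le> \<beta> < \<alpha>\<close>.
\<close>

inductive Sigma0 :: "(nat \<times> nat) set \<Rightarrow> 'a::topological_space set \<Rightarrow> bool" where
  Sigma0_one: "open A \<Longrightarrow> Sigma0 {(a, a)} A"
| Sigma0_union: "\<forall>n::nat. (\<beta> n, \<alpha>) \<in> ordLess \<and> Field (\<beta> n) \<noteq> {} \<and> Sigma0 (\<beta> n) (- A n)
    \<Longrightarrow> Sigma0 \<alpha> (\<Union>n. A n)"

definition Pi0 :: "(nat \<times> nat) set \<Rightarrow> 'a::topological_space set \<Rightarrow> bool" where
  "Pi0 \<alpha> A \<longleftrightarrow> Sigma0 \<alpha> (- A)"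

definition borel_rank :: "(nat \<times> nat) set \<Rightarrow> 'a::topological_space set \<Rightarrow> bool" where
  "borel_rank \<alpha> A \<longleftrightarrow> Sigma0 \<alpha> A \<or> Pi0 \<alpha> A"

end

(*
  Idea.  The relation bf L b x m y n is a back-and-forth relation of rank b between the pairs
  (x, V_m) and (y, V_n), V_m and V_n being basic open sets of the group; its ranks are the elements
  of a well-founded relation L.  By induction on the Borel hierarchy it transfers Vaught transforms:
  if it holds and nonmeagerly many g in V_m send x into a Sigma^0_gamma set A, where gamma embeds
  into L below b, then nonmeagerly many h in V_n send y into A.  For recursive L the relation is the
  unique solution of an arithmetical recursion in the data "r_i x in U_k" and "r_j y in U_k" for
  dense r_i, so for hyperarithmetic x the set of all z that are back-and-forth equivalent to x
  is Delta^1_1: guess the table of the relation existentially, or dually refute it.  This set is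
  invariant and contains x, hence contains y.  An invariant Sigma^0_alpha set with
  alpha <= omega_1^CK is a union of sets whose complements have rank beta < alpha, and each such
  beta is recursive.
*)
theory Submission
  imports Defs
begin

section \<open>Recursive functions of one coded argument\<close>

text \<open>The pairs must change places at every step down in rank. A union that is nonmeager on
  V_m has a nonmeager piece, and the Baire property makes this piece comeager on some smaller V_m'.
  Its complement, a set of lower rank, is then meager there, and the relation carries meagerness
  from the pair on the right to the pair on the left. The obstacle is definability. Quantifiers over
  group elements or open sets would be too complex, so all of them run over codes of basic sets and
  over a dense sequence, and inclusion of basic sets gives way to an inequality between radii that
  is recursive in \<zeta>. A table of the relation is then a function on numbers, and
  well-foundedness of L fixes which of its entries are 1. Hence a class and its complement can both
  be described by guessing a table. No single L serves all ranks: each recursive ordinal has its own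
  L, and L is chosen only after a piece of the given union has been singled out. This is how the
  bound \<omega>_1^CK itself is reached.\<close>

lemma length_2_conv: "length xs = 2 \<longleftrightarrow> (\<exists>a b. xs = [a, b])"
  by (auto simp: numeral_2_eq_2 length_Suc_conv)

lemma rec_fun_cong:
  "rec_fun \<zeta> k f \<Longrightarrow> (\<And>xs. length xs = k \<Longrightarrow> f xs = g xs) \<Longrightarrow> rec_fun \<zeta> k g"
  using rec_fun.cong by blast

lemma rec_fun_comp1: "rec_fun \<zeta> 1 (\<lambda>xs. f (xs ! 0)) \<Longrightarrow> rec_fun \<zeta> k a \<Longrightarrow> rec_fun \<zeta> k (\<lambda>xs. f (a xs))"
  using rec_fun.comp[of \<zeta> "[a]" "\<lambda>xs. f (xs ! 0)" k] by simp

lemma rec_fun_comp2: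
  "rec_fun \<zeta> 2 (\<lambda>xs. f (xs ! 0) (xs ! 1)) \<Longrightarrow> rec_fun \<zeta> k a \<Longrightarrow> rec_fun \<zeta> k b
    \<Longrightarrow> rec_fun \<zeta> k (\<lambda>xs. f (a xs) (b xs))"
  using rec_fun.comp[of \<zeta> "[a, b]" "\<lambda>xs. f (xs ! 0) (xs ! 1)" k] by (simp add: numeral_2_eq_2)

lemma rec_fun_prim2:
  assumes "rec_fun \<zeta> 1 (\<lambda>xs. f (xs ! 0))" and "rec_fun \<zeta> 3 (\<lambda>xs. g (xs ! 0) (xs ! 1) (xs ! 2))"
  shows "rec_fun \<zeta> 2 (\<lambda>xs. rec_nat (f (xs ! 1)) (\<lambda>n r. g n r (xs ! 1)) (xs ! 0))"
proof (rule rec_fun_cong)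
  show "rec_fun \<zeta> 2 (\<lambda>xs. rec_nat ((\<lambda>xs. f (xs ! 0)) (tl xs))
      (\<lambda>n r. (\<lambda>xs. g (xs ! 0) (xs ! 1) (xs ! 2)) (n # r # tl xs)) (hd xs))"
    using rec_fun.prim_rec[OF assms(1), of "\<lambda>xs. g (xs ! 0) (xs ! 1) (xs ! 2)"] assms(2)
    by (simp add: numeral_2_eq_2 numeral_3_eq_3)
qed (auto simp: length_2_conv)

lemma rec_fun_Suc: "rec_fun \<zeta> k a \<Longrightarrow> rec_fun \<zeta> k (\<lambda>xs. Suc (a xs))"
  by (rule rec_fun_comp1[OF rec_fun.succ])

lemma rec_fun_add: "rec_fun \<zeta> k a \<Longrightarrow> rec_fun \<zeta> k b \<Longrightarrow> rec_fun \<zeta> k (\<lambda>xs. a xs + b xs)"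
proof (rule rec_fun_comp2[of _ "(+)"])
  have "rec_fun \<zeta> 2 (\<lambda>xs. rec_nat (xs ! 1) (\<lambda>n r. Suc r) (xs ! 0))"
    by (rule rec_fun_prim2; intro rec_fun_Suc rec_fun.proj; simp)
  moreover have "rec_nat b (\<lambda>n r. Suc r) a = a + b" for a b :: nat
    by (induction a) auto
  ultimately show "rec_fun \<zeta> 2 (\<lambda>xs. xs ! 0 + xs ! 1)" by simp
qed

lemma rec_fun_mult: "rec_fun \<zeta> k a \<Longrightarrow> rec_fun \<zeta> k b \<Longrightarrow> rec_fun \<zeta> k (\<lambda>xs. a xs * b xs)"
proof (rule rec_fun_comp2[of _ "(*)"])
  have "rec_fun \<zeta> 2 (\<lambda>xs. rec_nat 0 (\<lambda>n r. r + xs ! 1) (xs ! 0))"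
    by (rule rec_fun_prim2; intro rec_fun_add rec_fun.proj rec_fun.zero; simp)
  moreover have "rec_nat 0 (\<lambda>n r. r + b) a = a * b" for a b :: nat
    by (induction a) auto
  ultimately show "rec_fun \<zeta> 2 (\<lambda>xs. xs ! 0 * xs ! 1)" by simp
qed

text \<open>Recursion runs on the first argument, which therefore is the number subtracted; hence
  the order \<open>b xs - a xs\<close>.\<close>

lemma rec_fun_diff:
  assumes "rec_fun \<zeta> k a" "rec_fun \<zeta> k b"
  shows "rec_fun \<zeta> k (\<lambda>xs. b xs - a xs)"
proof -
  have "rec_fun \<zeta> 2 (\<lambda>xs. rec_nat 0 (\<lambda>n r. n) (xs ! 0))"
    by (rule rec_fun_prim2; intro rec_fun.proj rec_fun.zero; simp)
  moreover have "rec_nat 0 (\<lambda>n r. n) a = a - 1" for a :: nat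
    by (induction a) auto
  ultimately have pred: "rec_fun \<zeta> 2 (\<lambda>xs. xs ! 0 - 1)" by simp
  have "rec_fun \<zeta> 2 (\<lambda>xs. rec_nat (xs ! 1) (\<lambda>n r. r - 1) (xs ! 0))"
  proof (rule rec_fun_prim2)
    show "rec_fun \<zeta> 3 (\<lambda>xs. xs ! 1 - 1)"
      by (rule rec_fun_comp2[OF pred, of 3 "\<lambda>xs. xs ! 1" "\<lambda>xs. xs ! 1"]) (auto intro: rec_fun.proj)
  qed (auto intro: rec_fun.proj)
  moreover have "rec_nat b (\<lambda>n r. r - 1) a = b - a" for a b :: nat
    by (induction a) auto
  ultimately have "rec_fun \<zeta> 2 (\<lambda>xs. xs ! 1 - xs ! 0)" by simp
  then show ?thesis by (rule rec_fun_comp2[OF _ assms])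
qed

lemma rec_fun_triangle: "rec_fun \<zeta> k a \<Longrightarrow> rec_fun \<zeta> k (\<lambda>xs. triangle (a xs))"
proof (rule rec_fun_comp2[where b = a, of _ "\<lambda>a b. triangle a"])
  have "rec_fun \<zeta> 2 (\<lambda>xs. rec_nat 0 (\<lambda>n r. r + Suc n) (xs ! 0))"
    by (rule rec_fun_prim2; intro rec_fun_Suc rec_fun_add rec_fun.proj rec_fun.zero; simp)
  moreover have "rec_nat 0 (\<lambda>n r. r + Suc n) a = triangle a" for a :: nat
    by (induction a) auto
  ultimately show "rec_fun \<zeta> 2 (\<lambda>xs. triangle (xs ! 0))" by simp
qed

lemma rec_fun_prod_encode:
  "rec_fun \<zeta> k a \<Longrightarrow> rec_fun \<zeta> k b \<Longrightarrow> rec_fun \<zeta> k (\<lambda>xs. prod_encode (a xs, b xs))"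
  by (auto simp: prod_encode_def intro!: rec_fun_add rec_fun_triangle)

section \<open>The inverses of the pairing function, and recursive functions of one packed
  argument\<close>

definition pf :: "nat \<Rightarrow> nat" where "pf e = fst (prod_decode e)"
definition ps :: "nat \<Rightarrow> nat" where "ps e = snd (prod_decode e)"

abbreviation pr :: "nat \<Rightarrow> nat \<Rightarrow> nat" where "pr a b \<equiv> prod_encode (a, b)"

lemma pf_pr [simp]: "pf (pr a b) = a" and ps_pr [simp]: "ps (pr a b) = b"
  by (simp_all add: pf_def ps_def)

lemma pr_pf_ps [simp]: "pr (pf e) (ps e) = e"
  by (simp add: pf_def ps_def)

lemma prod_decode_pf_ps: "prod_decode e = (pf e, ps e)"
  by (simp add: pf_def ps_def)

lemma pf_0 [simp]: "pf 0 = 0" and ps_0 [simp]: "ps 0 = 0"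
  by (simp_all add: pf_def ps_def prod_decode_def prod_decode_aux.simps)

text \<open>Only unary functions: parameters and bound variables are packed into one number and read
  back with \<open>pf\<close> and \<open>ps\<close>, so that the closure rules need no arities and
  can be applied by \<open>intro\<close>.\<close>

definition crec :: "(nat \<Rightarrow> nat) \<Rightarrow> (nat \<Rightarrow> nat) \<Rightarrow> bool" where
  "crec \<zeta> f \<longleftrightarrow> rec_fun \<zeta> 1 (\<lambda>xs. f (xs ! 0))"

definition crecp :: "(nat \<Rightarrow> nat) \<Rightarrow> (nat \<Rightarrow> bool) \<Rightarrow> bool" where
  "crecp \<zeta> P \<longleftrightarrow> crec \<zeta> (\<lambda>e. if P e then 1 else 0)"

named_theorems crec_intros

lemma crec_id [crec_intros]: "crec \<zeta> (\<lambda>e. e)"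
  by (simp add: crec_def rec_fun.proj)

lemma crec_Suc [crec_intros]: "crec \<zeta> a \<Longrightarrow> crec \<zeta> (\<lambda>e. Suc (a e))"
  unfolding crec_def by (rule rec_fun_Suc)

lemma crec_const [crec_intros]: "crec \<zeta> (\<lambda>e. c)"
  by (induction c) (auto simp: crec_def intro: rec_fun.zero rec_fun_Suc)

lemma crec_comp: "crec \<zeta> f \<Longrightarrow> crec \<zeta> a \<Longrightarrow> crec \<zeta> (\<lambda>e. f (a e))"
  unfolding crec_def by (rule rec_fun_comp1)

lemma crec_add [crec_intros]: "crec \<zeta> a \<Longrightarrow> crec \<zeta> b \<Longrightarrow> crec \<zeta> (\<lambda>e. a e + b e)"
  unfolding crec_def by (rule rec_fun_add)

lemma crec_mult [crec_intros]: "crec \<zeta> a \<Longrightarrow> crec \<zeta> b \<Longrightarrow> crec \<zeta> (\<lambda>e. a e * b e)"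
  unfolding crec_def by (rule rec_fun_mult)

lemma crec_diff [crec_intros]: "crec \<zeta> a \<Longrightarrow> crec \<zeta> b \<Longrightarrow> crec \<zeta> (\<lambda>e. a e - b e)"
  unfolding crec_def by (rule rec_fun_diff)

lemma crec_pr [crec_intros]: "crec \<zeta> a \<Longrightarrow> crec \<zeta> b \<Longrightarrow> crec \<zeta> (\<lambda>e. pr (a e) (b e))"
  unfolding crec_def by (rule rec_fun_prod_encode)

text \<open>The diagonal on which e lies: \<open>pr a b\<close> is
  \<open>triangle (a + b) + a\<close>, so the root is a + b. Truncated subtraction writes e <
  triangle (w + 1) as an equation with 0, the form in which minimization is available.\<close>

definition tri_root :: "nat \<Rightarrow> nat" where
  "tri_root e = (LEAST w. Suc e - triangle (Suc w) = 0)"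

lemma tri_root_pr: "tri_root (pr a b) = a + b"
  unfolding tri_root_def
proof (rule Least_equality)
  show "Suc (pr a b) - triangle (Suc (a + b)) = 0"
    by (simp add: prod_encode_def)
next
  fix w assume w: "Suc (pr a b) - triangle (Suc w) = 0"
  show "a + b \<le> w"
  proof (rule ccontr)
    assume "\<not> a + b \<le> w"
    then have "Suc w \<le> a + b" by simp
    then have "triangle (Suc w) \<le> triangle (a + b)"
      unfolding triangle_def by (intro div_le_mono mult_le_mono) auto
    with w show False by (simp add: prod_encode_def)
  qed
qed

lemma crec_tri_root: "crec \<zeta> tri_root"
proof -
  have ex: "\<exists>n. Suc e - triangle (Suc n) = 0" for e
    by (rule exI[of _ e]) (simp add: triangle_def)
  have "rec_fun \<zeta> 2 (\<lambda>xs. Suc (xs ! 1) - triangle (Suc (xs ! 0)))"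
    by (intro rec_fun_diff rec_fun_Suc rec_fun_triangle rec_fun.proj) auto
  then have "rec_fun \<zeta> 1 (\<lambda>xs. LEAST n. Suc ((n # xs) ! 1) - triangle (Suc ((n # xs) ! 0)) = 0)"
    by (intro rec_fun.minim) (use ex in \<open>simp_all add: numeral_2_eq_2 del: triangle_Suc\<close>)
  then show ?thesis
    unfolding crec_def tri_root_def by simp
qed

lemma pf_eq: "pf e = e - triangle (tri_root e)"
  using pr_pf_ps[of e] tri_root_pr[of "pf e" "ps e"] by (simp add: prod_encode_def)

lemma ps_eq: "ps e = tri_root e - pf e"
  using tri_root_pr[of "pf e" "ps e"] by simp

lemma crec_pf [crec_intros]: "crec \<zeta> a \<Longrightarrow> crec \<zeta> (\<lambda>e. pf (a e))"
proof (erule crec_comp[rotated])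
  have "crec \<zeta> (\<lambda>e. triangle (tri_root e))"
    using crec_tri_root[of \<zeta>] unfolding crec_def by (rule rec_fun_triangle)
  then show "crec \<zeta> pf"
    unfolding pf_eq[abs_def] by (intro crec_intros)
qed

lemma crec_ps [crec_intros]: "crec \<zeta> a \<Longrightarrow> crec \<zeta> (\<lambda>e. ps (a e))"
  by (erule crec_comp[rotated], unfold ps_eq[abs_def]) (intro crec_intros crec_tri_root)

lemma rec_fun_crec:
  "crec \<zeta> f \<Longrightarrow> rec_fun \<zeta> k a \<Longrightarrow> rec_fun \<zeta> k (\<lambda>xs. f (a xs))"
  unfolding crec_def by (rule rec_fun_comp1)

lemma crec_rec_nat [crec_intros]:
  assumes "crec \<zeta> f" and g: "crec \<zeta> (\<lambda>e. g (pf e) (pf (ps e)) (ps (ps e)))" and "crec \<zeta> a"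
  shows "crec \<zeta> (\<lambda>e. rec_nat (f e) (\<lambda>n r. g n r e) (a e))"
proof -
  have "rec_fun \<zeta> 2 (\<lambda>xs. rec_nat (f (xs ! 1)) (\<lambda>n r. g n r (xs ! 1)) (xs ! 0))"
  proof (rule rec_fun_prim2)
    have "rec_fun \<zeta> 3 (\<lambda>xs. pr (xs ! 0) (pr (xs ! 1) (xs ! 2)))"
      by (intro rec_fun_prod_encode rec_fun.proj) auto
    from rec_fun_crec[OF g this] show "rec_fun \<zeta> 3 (\<lambda>xs. g (xs ! 0) (xs ! 1) (xs ! 2))"
      by simp
  qed (use assms(1) in \<open>simp add: crec_def\<close>)
  from rec_fun_comp2[OF this, of 1 "\<lambda>xs. a (xs ! 0)" "\<lambda>xs. xs ! 0"] assms(3)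
  show ?thesis by (auto simp: crec_def intro: rec_fun.proj)
qed

section \<open>Predicates recursive in the oracle\<close>

lemma crecp_cong: "crecp \<zeta> P \<Longrightarrow> (\<And>e. P e = Q e) \<Longrightarrow> crecp \<zeta> Q"
  by (rule back_subst[of "crecp \<zeta>" P]) auto

lemma crecp_comp: "crecp \<zeta> P \<Longrightarrow> crec \<zeta> a \<Longrightarrow> crecp \<zeta> (\<lambda>e. P (a e))"
  unfolding crecp_def by (rule crec_comp)

lemma crecp_not [crec_intros]: "crecp \<zeta> P \<Longrightarrow> crecp \<zeta> (\<lambda>e. \<not> P e)"
proof -
  assume "crecp \<zeta> P"
  then have "crec \<zeta> (\<lambda>e. 1 - (if P e then 1 else 0))"
    unfolding crecp_def by (intro crec_intros)
  then show ?thesis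
    unfolding crecp_def by (rule back_subst[of "crec \<zeta>"]) auto
qed

lemma crecp_conj [crec_intros]: "crecp \<zeta> P \<Longrightarrow> crecp \<zeta> Q \<Longrightarrow> crecp \<zeta> (\<lambda>e. P e \<and> Q e)"
proof -
  assume "crecp \<zeta> P" "crecp \<zeta> Q"
  then have "crec \<zeta> (\<lambda>e. (if P e then 1 else 0) * (if Q e then 1 else 0))"
    unfolding crecp_def by (intro crec_intros)
  then show ?thesis
    unfolding crecp_def by (rule back_subst[of "crec \<zeta>"]) auto
qed

lemma crecp_disj [crec_intros]: "crecp \<zeta> P \<Longrightarrow> crecp \<zeta> Q \<Longrightarrow> crecp \<zeta> (\<lambda>e. P e \<or> Q e)"
  by (rule crecp_cong[where P = "\<lambda>e. \<not> (\<not> P e \<and> \<not> Q e)"], intro crec_intros) simp_all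

lemma crecp_imp [crec_intros]: "crecp \<zeta> P \<Longrightarrow> crecp \<zeta> Q \<Longrightarrow> crecp \<zeta> (\<lambda>e. P e \<longrightarrow> Q e)"
  by (rule crecp_cong[where P = "\<lambda>e. \<not> (P e \<and> \<not> Q e)"], intro crec_intros) simp_all

lemma crecp_le [crec_intros]: "crec \<zeta> a \<Longrightarrow> crec \<zeta> b \<Longrightarrow> crecp \<zeta> (\<lambda>e. a e \<le> b e)"
proof -
  assume "crec \<zeta> a" "crec \<zeta> b"
  then have "crec \<zeta> (\<lambda>e. 1 - (a e - b e))"
    by (intro crec_intros)
  then show ?thesis
    unfolding crecp_def by (rule back_subst[of "crec \<zeta>"]) auto
qed

lemma crecp_less [crec_intros]: "crec \<zeta> a \<Longrightarrow> crec \<zeta> b \<Longrightarrow> crecp \<zeta> (\<lambda>e. a e < b e)"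
  by (rule crecp_cong[where P = "\<lambda>e. \<not> b e \<le> a e"], intro crec_intros) auto

lemma crecp_eq [crec_intros]: "crec \<zeta> a \<Longrightarrow> crec \<zeta> b \<Longrightarrow> crecp \<zeta> (\<lambda>e. a e = b e)"
  by (rule crecp_cong[where P = "\<lambda>e. a e \<le> b e \<and> b e \<le> a e"], intro crec_intros) auto

lemma crec_if [crec_intros]:
  assumes "crecp \<zeta> P" "crec \<zeta> a" "crec \<zeta> b"
  shows "crec \<zeta> (\<lambda>e. if P e then a e else b e)"
proof -
  have "crec \<zeta> (\<lambda>e. (if P e then 1 else 0) * a e + (if \<not> P e then 1 else 0) * b e)"
    using assms(1) crecp_not[OF assms(1)] assms(2,3) unfolding crecp_def by (intro crec_add crec_mult)
  then show ?thesis by (rule back_subst[of "crec \<zeta>"]) auto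
qed

lemma crecp_if [crec_intros]:
  "crecp \<zeta> P \<Longrightarrow> crecp \<zeta> Q \<Longrightarrow> crecp \<zeta> R \<Longrightarrow> crecp \<zeta> (\<lambda>e. if P e then Q e else R e)"
  by (rule crecp_cong[where P = "\<lambda>e. (P e \<longrightarrow> Q e) \<and> (\<not> P e \<longrightarrow> R e)"], intro crec_intros) auto

lemma crec_Least [crec_intros]:
  assumes P: "crecp \<zeta> (\<lambda>e. P (pf e) (ps e))" and ex: "\<And>e. \<exists>n. P n e"
  shows "crec \<zeta> (\<lambda>e. LEAST n. P n e)"
proof -
  have "rec_fun \<zeta> 2 (\<lambda>xs. pr (xs ! 0) (xs ! 1))"
    by (intro rec_fun_prod_encode rec_fun.proj) auto
  \<comment> \<open>Minimization looks for a zero, so here truth has the value 0.\<close>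
  from rec_fun_crec[OF crecp_not[OF P, unfolded crecp_def] this]
  have "rec_fun \<zeta> 2 (\<lambda>xs. if P (xs ! 0) (xs ! 1) then 0 else 1)"
    by (rule rec_fun_cong) simp
  then have "rec_fun \<zeta> 1 (\<lambda>xs. LEAST n. (if P ((n # xs) ! 0) ((n # xs) ! 1) then 0 else 1) = (0::nat))"
    by (intro rec_fun.minim) (auto simp: numeral_2_eq_2 ex)
  then show ?thesis unfolding crec_def by (rule rec_fun_cong) simp
qed

text \<open>A search for the first counterexample that also stops at \<open>a e\<close>. The
  stopping value makes the minimization total, and it is the result exactly when no earlier
  counterexample exists.\<close>

lemma crecp_ball [crec_intros]:
  assumes "crecp \<zeta> (\<lambda>e. P (pf e) (ps e))" "crec \<zeta> a"
  shows "crecp \<zeta> (\<lambda>e. \<forall>l<a e. P l e)"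
proof (rule crecp_cong[where P = "\<lambda>e. (LEAST n. n = a e \<or> \<not> P n e) = a e"])
  have "crec \<zeta> (\<lambda>e. a (ps e))"
    using assms(2) by (rule crec_comp) (intro crec_intros)
  then show "crecp \<zeta> (\<lambda>e. (LEAST n. n = a e \<or> \<not> P n e) = a e)"
    by (intro crec_intros assms) auto
next
  fix e
  show "((LEAST n. n = a e \<or> \<not> P n e) = a e) = (\<forall>l<a e. P l e)"
  proof
    assume "(LEAST n. n = a e \<or> \<not> P n e) = a e"
    then show "\<forall>l<a e. P l e" by (metis (mono_tags, lifting) not_less_Least)
  next
    assume "\<forall>l<a e. P l e"
    then show "(LEAST n. n = a e \<or> \<not> P n e) = a e"
      by (intro Least_equality) (auto simp: not_less[symmetric])
  qed
qed

lemma crecp_rec_rel2: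
  assumes "rec_rel \<zeta> 2 R" "crec \<zeta> a" "crec \<zeta> b"
  shows "crecp \<zeta> (\<lambda>e. R [a e, b e])"
  using rec_fun.comp[of \<zeta> "[\<lambda>xs. a (xs ! 0), \<lambda>xs. b (xs ! 0)]" "\<lambda>xs. if R xs then 1 else 0" 1] assms
  by (simp add: crecp_def crec_def rec_rel_def numeral_2_eq_2)

lemma crecp_rec_rel4:
  assumes "rec_rel \<zeta> 4 R" "crec \<zeta> a" "crec \<zeta> b" "crec \<zeta> c" "crec \<zeta> d"
  shows "crecp \<zeta> (\<lambda>e. R [a e, b e, c e, d e])"
  using rec_fun.comp[of \<zeta> "[\<lambda>xs. a (xs ! 0), \<lambda>xs. b (xs ! 0), \<lambda>xs. c (xs ! 0), \<lambda>xs. d (xs ! 0)]"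
      "\<lambda>xs. if R xs then 1 else 0" 1] assms
  by (simp add: crecp_def crec_def rec_rel_def eval_nat_numeral)

lemma re_in_crecp:
  assumes "crecp \<zeta> (\<lambda>e. P (pf e) (ps e))"
  shows "re_in \<zeta> {n. \<exists>m. P n m}"
proof -
  have "rec_fun \<zeta> 2 (\<lambda>xs. pr (xs ! 0) (xs ! 1))"
    by (intro rec_fun_prod_encode rec_fun.proj) auto
  from rec_fun_crec[OF assms[unfolded crecp_def] this]
  have "rec_rel \<zeta> 2 (\<lambda>xs. P (xs ! 0) (xs ! 1))"
    by (simp add: rec_rel_def)
  then show ?thesis unfolding re_in_def by force
qed

lemma re_inE:
  assumes "re_in \<zeta> W"
  obtains R where "crecp \<zeta> (\<lambda>e. R (pf e) (ps e))" "\<And>n. n \<in> W \<longleftrightarrow> (\<exists>m. R n m)"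
proof -
  from assms obtain R where R: "rec_rel \<zeta> 2 R" and W: "W = {n. \<exists>m. R [n, m]}"
    by (auto simp: re_in_def)
  show thesis
  proof (rule that[of "\<lambda>n m. R [n, m]"])
    show "crecp \<zeta> (\<lambda>e. R [pf e, ps e])"
      by (intro crecp_rec_rel2[OF R] crec_intros)
  qed (use W in simp)
qed


section \<open>Codes of finite sequences\<close>

definition len :: "nat \<Rightarrow> nat" where "len v = length (list_decode v)"

definition nthc :: "nat \<Rightarrow> nat \<Rightarrow> nat" where
  "nthc v l = (if l < len v then list_decode v ! l else 0)"

text \<open>Iterated tail on codes. A nonempty list has the code \<open>Suc (pr head tail)\<close>;
  the empty one has code 0, which is fixed because \<open>ps (0 - 1) = 0\<close>.\<close>

definition dropc :: "nat \<Rightarrow> nat \<Rightarrow> nat" where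
  "dropc v l = rec_nat v (\<lambda>_ r. ps (r - 1)) l"

lemma list_decode_nonzero: "v \<noteq> 0 \<Longrightarrow> list_decode v = pf (v - 1) # list_decode (ps (v - 1))"
  by (cases v) (simp_all add: prod_decode_pf_ps)

lemma list_decode_dropc: "list_decode (dropc v l) = drop l (list_decode v)"
proof (induction l)
  case (Suc l)
  have "dropc v (Suc l) = ps (dropc v l - 1)" by (simp add: dropc_def)
  moreover have "list_decode (ps (w - 1)) = tl (list_decode w)" for w
    by (cases "w = 0") (simp_all add: list_decode_nonzero)
  ultimately show ?case
    using Suc by (simp add: tl_drop drop_Suc)
qed (simp add: dropc_def)

lemma dropc_eq_0_iff: "dropc v l = 0 \<longleftrightarrow> len v \<le> l"
proof -
  have "dropc v l = 0 \<longleftrightarrow> list_decode (dropc v l) = []"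
    by (metis list_decode.simps(1) list_decode_inverse list_encode.simps(1))
  then show ?thesis by (simp add: list_decode_dropc len_def)
qed

lemma nthc_eq: "nthc v l = pf (dropc v l - 1)"
proof (cases "l < len v")
  case True
  then have "dropc v l \<noteq> 0" using dropc_eq_0_iff by simp
  then have "pf (dropc v l - 1) = hd (list_decode (dropc v l))"
    by (simp add: list_decode_nonzero)
  then show ?thesis
    using True by (simp add: nthc_def list_decode_dropc hd_drop_conv_nth len_def)
next
  case False
  then have "dropc v l = 0" using dropc_eq_0_iff by simp
  then show ?thesis using False by (simp add: nthc_def)
qed

lemma crec_dropc: "crec \<zeta> a \<Longrightarrow> crec \<zeta> b \<Longrightarrow> crec \<zeta> (\<lambda>e. dropc (a e) (b e))"
  unfolding dropc_def by (intro crec_intros)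

lemma crec_nthc [crec_intros]: "crec \<zeta> a \<Longrightarrow> crec \<zeta> b \<Longrightarrow> crec \<zeta> (\<lambda>e. nthc (a e) (b e))"
  unfolding nthc_eq by (intro crec_intros crec_dropc)

lemma len_Least: "len v = (LEAST n. dropc v n = 0)"
  by (rule Least_equality[symmetric]) (simp_all add: dropc_eq_0_iff)

lemma crec_len [crec_intros]: "crec \<zeta> a \<Longrightarrow> crec \<zeta> (\<lambda>e. len (a e))"
proof (erule crec_comp[rotated])
  show "crec \<zeta> len"
    unfolding len_Least[abs_def] by (intro crec_intros crec_dropc) (auto simp: dropc_eq_0_iff)
qed

lemma pseq_baire_pres: "pseq baire_pres j = nthc j"
  by (auto simp: baire_pres_def nthc_def len_def)

definition pref :: "nat \<Rightarrow> (nat \<Rightarrow> nat) \<Rightarrow> bool" where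
  "pref v f \<longleftrightarrow> (\<forall>l<len v. nthc v l = f l)"

definition initc :: "(nat \<Rightarrow> nat) \<Rightarrow> nat \<Rightarrow> nat" where
  "initc f n = list_encode (map f [0..<n])"

lemma len_initc [simp]: "len (initc f n) = n"
  by (simp add: len_def initc_def)

lemma nthc_initc [simp]: "l < n \<Longrightarrow> nthc (initc f n) l = f l"
  by (simp add: nthc_def) (simp add: initc_def)

lemma pref_initc [simp]: "pref (initc f n) f"
  by (simp add: pref_def)


section \<open>Presented spaces\<close>

definition rad :: "nat \<Rightarrow> real" where
  "rad n = real (Suc (pf (ps n))) / real (Suc (ps (ps n)))"

lemma rad_pos [simp]: "rad n > 0"
  by (simp add: rad_def)

lemma mem_basic_open: "x \<in> basic_open P n \<longleftrightarrow> pdist P x (pseq P (pf n)) < rad n"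
  by (simp add: basic_open_def prod_decode_pf_ps rad_def add.commute)

text \<open>Formal inclusion: the triangle inequality turns it into inclusion of the balls. It is
  recursive in \<zeta>, which inclusion itself need not be.\<close>

definition finc :: "'a presentation \<Rightarrow> nat \<Rightarrow> nat \<Rightarrow> bool" where
  "finc P n m \<longleftrightarrow> pdist P (pseq P (pf n)) (pseq P (pf m)) + rad n < rad m"

locale presented =
  fixes \<zeta> :: "nat \<Rightarrow> nat" and P :: "'a::topological_space presentation"
  assumes presented: "presented_in \<zeta> P"
begin

abbreviation "U \<equiv> basic_open P"
abbreviation "r \<equiv> pseq P"
abbreviation "d \<equiv> pdist P"

sublocale M: Metric_space UNIV d
  using presented by (simp add: presented_in_def)

lemma mtopology: "M.mtopology = euclidean"
  and mcomplete: "M.mcomplete"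
  and dense: "closure (range r) = UNIV"
  and rec_less: "rec_rel \<zeta> 4 (\<lambda>xs. d (r (xs ! 0)) (r (xs ! 1)) < real (xs ! 3) / (real (xs ! 2) + 1))"
  using presented by (auto simp: presented_in_def)

lemma open_metric: "open S \<longleftrightarrow> (\<forall>x\<in>S. \<exists>e>0. \<forall>y. d x y < e \<longrightarrow> y \<in> S)"
proof -
  have "open S \<longleftrightarrow> openin M.mtopology S" by (simp add: mtopology)
  also have "\<dots> \<longleftrightarrow> (\<forall>x\<in>S. \<exists>e>0. M.mball x e \<subseteq> S)" by (auto simp: M.openin_mtopology)
  finally show ?thesis by (simp add: subset_eq Ball_def M.in_mball)
qed

lemma open_dball: "open {y. d x y < e}"
proof -
  have "openin M.mtopology (M.mball x e)" by (rule M.openin_mball)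
  then show ?thesis by (simp add: mtopology M.mball_def)
qed

lemma open_basic [simp]: "open (U n)"
proof -
  have "U n = {y. d (r (pf n)) y < rad n}" by (auto simp: mem_basic_open M.commute)
  then show ?thesis by (simp add: open_dball)
qed

lemma dense_meets:
  assumes "open S" "x \<in> S"
  obtains i where "r i \<in> S"
  using open_Int_closure_eq_empty[OF assms(1), of "range r"] assms(2) dense by auto

lemma dense_near:
  assumes "e > 0"
  obtains i where "d x (r i) < e"
proof -
  have "x \<in> {y. d x y < e}" using assms by simp
  then obtain i where "r i \<in> {y. d x y < e}" by (rule dense_meets[OF open_dball])
  then show thesis using that by simp
qed

lemma center_mem: "r (pf n) \<in> U n"
  by (simp add: mem_basic_open)

lemma finc_subset: "finc P n m \<Longrightarrow> U n \<subseteq> U m"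
proof
  fix x assume "finc P n m" "x \<in> U n"
  then show "x \<in> U m"
    using M.triangle[of x "r (pf n)" "r (pf m)"] by (simp add: mem_basic_open finc_def)
qed

text \<open>Radius \<open>1 / (k + 1)\<close> is coded by numerator \<open>0\<close>.\<close>

lemma small_basic:
  assumes "x \<in> U m" "open S" "x \<in> S"
  shows "\<exists>k\<ge>N. \<exists>i. x \<in> U (pr i (pr 0 k)) \<and> U (pr i (pr 0 k)) \<subseteq> S \<and> finc P (pr i (pr 0 k)) m"
proof -
  from assms obtain e where e: "e > 0" "\<And>y. d x y < e \<Longrightarrow> y \<in> S"
    unfolding open_metric by blast
  \<comment> \<open>Three bounds on the radius: e / 2, since two points of the ball are less than
    two radii apart; half the slack of x in \<open>U m\<close>, since formal inclusion pays for the
    shifted center and for the radius; 1 / (N + 1), to force N \<le> k.\<close>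
  define q where "q = min (e / 2) (min ((rad m - d x (r (pf m))) / 2) (1 / (real N + 1)))"
  have q: "q > 0" using assms(1) e by (simp add: q_def mem_basic_open)
  then obtain k where k: "1 / real (Suc k) < q"
    using nat_approx_posE by blast
  have "1 / real (Suc k) < 1 / real (Suc N)" using k by (simp add: q_def add.commute)
  then have "N \<le> k" by (simp add: field_simps)
  obtain i where i: "d x (r i) < 1 / real (Suc k)"
    by (rule dense_near[of "1 / real (Suc k)"]) simp
  let ?n = "pr i (pr 0 k)"
  have rad: "rad ?n = 1 / real (Suc k)" by (simp add: rad_def)
  have xn: "x \<in> U ?n" using i by (simp add: mem_basic_open rad)
  have "U ?n \<subseteq> S"
  proof
    fix y assume "y \<in> U ?n"
    then have "d x y < 2 / real (Suc k)"
      using M.triangle[of x "r i" y] i by (simp add: mem_basic_open rad M.commute)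
    also have "\<dots> < e" using k by (simp add: q_def)
    finally show "y \<in> S" using e by blast
  qed
  moreover have "finc P ?n m"
  proof -
    have "d (r i) (r (pf m)) \<le> d x (r i) + d x (r (pf m))"
      using M.triangle[of "r i" x "r (pf m)"] by (simp add: M.commute)
    moreover have "2 / real (Suc k) < rad m - d x (r (pf m))" using k by (simp add: q_def)
    ultimately show ?thesis using i by (simp add: finc_def rad)
  qed
  ultimately show ?thesis using xn \<open>N \<le> k\<close> by blast
qed

lemma exists_finc:
  assumes "x \<in> U m" "open S" "x \<in> S"
  obtains n where "x \<in> U n" "U n \<subseteq> S" "finc P n m"
  using small_basic[OF assms, of 0] by blast

lemma covering: "\<exists>n. x \<in> U n"
proof -
  obtain i where "d x (r i) < 1" by (rule dense_near[of 1]) simp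
  then have "x \<in> U (pr i (pr 0 0))" by (simp add: mem_basic_open rad_def)
  then show ?thesis ..
qed

lemma exists_basic:
  assumes "open S" "x \<in> S"
  obtains n where "x \<in> U n" "U n \<subseteq> S"
  using covering[of x] exists_finc[OF _ assms] by blast

lemma crecp_dist [crec_intros]:
  assumes "crec \<zeta> a" "crec \<zeta> b" "crec \<zeta> m" "crec \<zeta> k"
  shows "crecp \<zeta> (\<lambda>e. d (r (a e)) (r (b e)) < real (m e) / real (Suc (k e)))"
  using crecp_rec_rel4[OF rec_less assms(1,2,4,3)] by (simp add: add.commute)

lemma crecp_dist_rad:
  assumes "crec \<zeta> a" "crec \<zeta> b" "crec \<zeta> n"
  shows "crecp \<zeta> (\<lambda>e. d (r (a e)) (r (b e)) < rad (n e))"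
  unfolding rad_def by (intro crec_intros assms)

lemma crecp_mem_basic [crec_intros]:
  "crec \<zeta> a \<Longrightarrow> crec \<zeta> n \<Longrightarrow> crecp \<zeta> (\<lambda>e. r (a e) \<in> U (n e))"
  unfolding mem_basic_open by (intro crecp_dist_rad crec_intros)

text \<open>Truncated subtraction is harmless here: \<open>d < 0\<close> is false.\<close>

lemma finc_iff:
  "finc P n m \<longleftrightarrow> d (r (pf n)) (r (pf m)) <
     real (Suc (pf (ps m)) * Suc (ps (ps n)) - Suc (pf (ps n)) * Suc (ps (ps m)))
       / real (Suc (Suc (ps (ps n)) * Suc (ps (ps m)) - 1))"
proof -
  define A where "A = Suc (pf (ps m))"
  define K where "K = Suc (ps (ps m))"
  define A' where "A' = Suc (pf (ps n))"
  define K' where "K' = Suc (ps (ps n))"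
  have pos: "K > 0" "K' > 0" by (simp_all add: K_def K'_def)
  have "rad m - rad n = (real (A * K') - real (A' * K)) / real (K' * K)"
    using pos by (simp add: rad_def A_def[symmetric] K_def[symmetric] A'_def[symmetric] K'_def[symmetric] field_simps)
  moreover have "t < (real (A * K') - real (A' * K)) / real (K' * K)
      \<longleftrightarrow> t < real (A * K' - A' * K) / real (K' * K)" if "t \<ge> 0" for t
  proof (cases "A' * K \<le> A * K'")
    case False
    then have "(real (A * K') - real (A' * K)) / real (K' * K) \<le> 0"
      using pos by (intro divide_nonpos_pos) (simp_all del: of_nat_mult)
    with False that show ?thesis by simp
  qed (simp add: of_nat_diff)
  \<comment> \<open>The positive denominator has to be displayed as a successor for the rule
    \<open>crecp_dist\<close>.\<close>
  moreover have "Suc (K' * K - 1) = K' * K" using pos by simp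
  ultimately show ?thesis
    using M.nonneg by (simp add: finc_def A_def[symmetric] K_def[symmetric] A'_def[symmetric] K'_def[symmetric]
        less_diff_eq[symmetric] del: of_nat_mult)
qed

lemma crecp_finc [crec_intros]:
  "crec \<zeta> n \<Longrightarrow> crec \<zeta> m \<Longrightarrow> crecp \<zeta> (\<lambda>e. finc P (n e) (m e))"
  unfolding finc_iff by (intro crec_intros)

end


section \<open>Effective classes of relations\<close>

text \<open>
  Relations \<open>A e z f\<close> have a number \<open>e\<close> coding all numerical parameters, a point \<open>z\<close> and a function \<open>f\<close>
  coding all function parameters. Membership in an effectively open relation is witnessed by a code
  \<open>v\<close> of an initial segment of \<open>f\<close>, a basic neighbourhood of \<open>z\<close> and a number \<open>w\<close>.
\<close>

definition O01 :: "(nat \<Rightarrow> nat) \<Rightarrow> 'a presentation \<Rightarrow> (nat \<Rightarrow> 'a \<Rightarrow> (nat \<Rightarrow> nat) \<Rightarrow> bool) \<Rightarrow> bool" where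
  "O01 \<zeta> P A \<longleftrightarrow> (\<exists>Q. crecp \<zeta> Q \<and> (\<forall>e z f. A e z f \<longleftrightarrow>
     (\<exists>v u w. pref v f \<and> Q (pr e (pr v (pr u w))) \<and> z \<in> basic_open P u)))"

lemma O01I:
  assumes "crecp \<zeta> (\<lambda>e. Q (pf e) (pf (ps e)) (pf (ps (ps e))) (ps (ps (ps e))))"
    and "\<And>e z f. A e z f \<longleftrightarrow> (\<exists>v u w. pref v f \<and> Q e v u w \<and> z \<in> basic_open P u)"
  shows "O01 \<zeta> P A"
  unfolding O01_def by (rule exI, rule conjI, rule assms(1)) (simp add: assms(2))

lemma O01E:
  assumes "O01 \<zeta> P A"
  obtains Q where "crecp \<zeta> Q"
    "\<And>e z f. A e z f \<longleftrightarrow> (\<exists>v u w. pref v f \<and> Q (pr e (pr v (pr u w))) \<and> z \<in> basic_open P u)"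
  using assms unfolding O01_def by blast

lemma O01_cong: "O01 \<zeta> P A \<Longrightarrow> (\<And>e z f. A e z f = B e z f) \<Longrightarrow> O01 \<zeta> P B"
  by (rule back_subst[of "O01 \<zeta> P" A]) (auto intro!: ext)

lemma O01_basic:
  assumes "crecp \<zeta> R" "crec \<zeta> u" "crec \<zeta> v"
  shows "O01 \<zeta> P (\<lambda>e z f. R e \<and> z \<in> basic_open P (u e) \<and> pref (v e) f)"
  by (rule O01I[where Q = "\<lambda>e v' u' w. R e \<and> u' = u e \<and> v' = v e"])
    (auto intro!: crec_intros crecp_comp[OF assms(1)] crec_comp[OF assms(2)] crec_comp[OF assms(3)])

lemma O01_subst:
  assumes "O01 \<zeta> P A" "crec \<zeta> s"
  shows "O01 \<zeta> P (\<lambda>e z f. A (s e) z f)"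
proof -
  from assms(1) obtain Q where Q: "crecp \<zeta> Q" and A: "\<And>e z f. A e z f \<longleftrightarrow>
      (\<exists>v u w. pref v f \<and> Q (pr e (pr v (pr u w))) \<and> z \<in> basic_open P u)" by (rule O01E) blast
  show ?thesis
    by (rule O01I[where Q = "\<lambda>e v u w. Q (pr (s e) (pr v (pr u w)))"])
      (auto intro!: crec_intros crecp_comp[OF Q] crec_comp[OF assms(2)] simp: A)
qed

lemma O01_if:
  assumes "crecp \<zeta> R" "O01 \<zeta> P A" "O01 \<zeta> P B"
  shows "O01 \<zeta> P (\<lambda>e z f. if R e then A e z f else B e z f)"
proof -
  from assms(2) obtain Q where Q: "crecp \<zeta> Q" and A: "\<And>e z f. A e z f \<longleftrightarrow>
      (\<exists>v u w. pref v f \<and> Q (pr e (pr v (pr u w))) \<and> z \<in> basic_open P u)" by (rule O01E) blast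
  from assms(3) obtain Q' where Q': "crecp \<zeta> Q'" and B: "\<And>e z f. B e z f \<longleftrightarrow>
      (\<exists>v u w. pref v f \<and> Q' (pr e (pr v (pr u w))) \<and> z \<in> basic_open P u)" by (rule O01E) blast
  show ?thesis
  proof (rule O01I)
    show "crecp \<zeta> (\<lambda>e. (\<lambda>e v u w. if R e then Q (pr e (pr v (pr u w))) else Q' (pr e (pr v (pr u w))))
        (pf e) (pf (ps e)) (pf (ps (ps e))) (ps (ps (ps e))))"
      by (intro crec_intros crecp_comp[OF Q] crecp_comp[OF Q'] crecp_comp[OF assms(1)])
  qed (auto simp: A B)
qed

text \<open>The quantified number is stored in the witness: \<open>pf w\<close> is n and
  \<open>ps w\<close> is the old witness.\<close>

lemma O01_ex:
  assumes "O01 \<zeta> P (\<lambda>e z f. A (pf e) (ps e) z f)"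
  shows "O01 \<zeta> P (\<lambda>e z f. \<exists>n. A n e z f)"
proof -
  from assms obtain Q where Q: "crecp \<zeta> Q" and A: "\<And>e z f. A (pf e) (ps e) z f \<longleftrightarrow>
      (\<exists>v u w. pref v f \<and> Q (pr e (pr v (pr u w))) \<and> z \<in> basic_open P u)" by (rule O01E) blast
  have A': "A n e z f \<longleftrightarrow> (\<exists>v u w. pref v f \<and> Q (pr (pr n e) (pr v (pr u w))) \<and> z \<in> basic_open P u)"
    for n e z f using A[of "pr n e"] by simp
  show ?thesis
  proof (rule O01I)
    show "crecp \<zeta> (\<lambda>e. (\<lambda>e v u w. Q (pr (pr (pf w) e) (pr v (pr u (ps w)))))
        (pf e) (pf (ps e)) (pf (ps (ps e))) (ps (ps (ps e))))"
      by (intro crec_intros crecp_comp[OF Q])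
  next
    fix e z f
    show "(\<exists>n. A n e z f) \<longleftrightarrow> (\<exists>v u w. pref v f \<and>
        Q (pr (pr (pf w) e) (pr v (pr u (ps w)))) \<and> z \<in> basic_open P u)"
      unfolding A' by (metis pf_pr ps_pr)
  qed
qed

text \<open>The witness is extended by the initial segment that sufficed before the substitution.\<close>

lemma O01_value:
  assumes "O01 \<zeta> P A" "crec \<zeta> t"
  shows "O01 \<zeta> P (\<lambda>e z f. A (pr e (f (t e))) z f)"
proof -
  from assms(1) obtain Q where Q: "crecp \<zeta> Q" and A: "\<And>e z f. A e z f \<longleftrightarrow>
      (\<exists>v u w. pref v f \<and> Q (pr e (pr v (pr u w))) \<and> z \<in> basic_open P u)" by (rule O01E) blast
  let ?Q = "\<lambda>e v u w. (t e < len v \<and> (\<forall>l<len (pf w). l < len v \<and> nthc v l = nthc (pf w) l))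
      \<and> Q (pr (pr e (nthc v (t e))) (pr (pf w) (pr u (ps w))))"
  show ?thesis
  proof (rule O01I[where Q = ?Q])
    show "crecp \<zeta> (\<lambda>e. ?Q (pf e) (pf (ps e)) (pf (ps (ps e))) (ps (ps (ps e))))"
      by (intro crec_intros crecp_comp[OF Q] crec_comp[OF assms(2)])
  next
    fix e z f
    show "A (pr e (f (t e))) z f \<longleftrightarrow> (\<exists>v u w. pref v f \<and> ?Q e v u w \<and> z \<in> basic_open P u)"
    proof
      assume "A (pr e (f (t e))) z f"
      then obtain v u w where *: "pref v f" "Q (pr (pr e (f (t e))) (pr v (pr u w)))" "z \<in> basic_open P u"
        unfolding A by blast
      let ?v = "initc f (Suc (t e) + len v)"
      have "?Q e ?v u (pr v w)" using * by (simp add: pref_def)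
      then show "\<exists>v u w. pref v f \<and> ?Q e v u w \<and> z \<in> basic_open P u"
        using * pref_initc by blast
    next
      assume "\<exists>v u w. pref v f \<and> ?Q e v u w \<and> z \<in> basic_open P u"
      then obtain v u w where *: "pref v f" "?Q e v u w" "z \<in> basic_open P u" by blast
      then have "pref (pf w) f" "nthc v (t e) = f (t e)" by (auto simp: pref_def)
      then show "A (pr e (f (t e))) z f"
        unfolding A using * by metis
    qed
  qed
qed

text \<open>A witness inspects finitely many values of the reindexed function, and a long enough
  initial segment of f supplies them; the old segment moves into w. Through such reindexings a
  single f carries several function parameters.\<close>

lemma O01_fun:
  assumes "O01 \<zeta> P A" "crec \<zeta> s"
  shows "O01 \<zeta> P (\<lambda>e z f. A e z (\<lambda>l. f (s (pr e l))))"
proof -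
  from assms(1) obtain Q where Q: "crecp \<zeta> Q" and A: "\<And>e z f. A e z f \<longleftrightarrow>
      (\<exists>v u w. pref v f \<and> Q (pr e (pr v (pr u w))) \<and> z \<in> basic_open P u)" by (rule O01E) blast
  let ?Q = "\<lambda>e v u w. (\<forall>l<len (pf w). s (pr e l) < len v \<and> nthc v (s (pr e l)) = nthc (pf w) l)
      \<and> Q (pr e (pr (pf w) (pr u (ps w))))"
  show ?thesis
  proof (rule O01I[where Q = ?Q])
    show "crecp \<zeta> (\<lambda>e. ?Q (pf e) (pf (ps e)) (pf (ps (ps e))) (ps (ps (ps e))))"
      by (intro crec_intros crecp_comp[OF Q] crec_comp[OF assms(2)])
  next
    fix e z f
    show "A e z (\<lambda>l. f (s (pr e l))) \<longleftrightarrow> (\<exists>v u w. pref v f \<and> ?Q e v u w \<and> z \<in> basic_open P u)"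
    proof
      assume "A e z (\<lambda>l. f (s (pr e l)))"
      then obtain v u w where *: "pref v (\<lambda>l. f (s (pr e l)))" "Q (pr e (pr v (pr u w)))"
        "z \<in> basic_open P u" unfolding A by blast
      \<comment> \<open>N exceeds every index of f that is consulted; \<open>{..len v}\<close>
        rather than \<open>{..<len v}\<close> keeps the set nonempty for \<open>Max\<close>.\<close>
      define N where "N = Suc (Max ((\<lambda>l. s (pr e l)) ` {..len v}))"
      have "s (pr e l) < N" if "l < len v" for l
        using that unfolding N_def by (intro le_imp_less_Suc Max_ge) auto
      then have "?Q e (initc f N) u (pr v w)" using * by (simp add: pref_def)
      then show "\<exists>v u w. pref v f \<and> ?Q e v u w \<and> z \<in> basic_open P u"
        using * pref_initc by blast
    next
      assume "\<exists>v u w. pref v f \<and> ?Q e v u w \<and> z \<in> basic_open P u"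
      then obtain v u w where *: "pref v f" "?Q e v u w" "z \<in> basic_open P u" by blast
      then have "pref (pf w) (\<lambda>l. f (s (pr e l)))" by (auto simp: pref_def)
      then show "A e z (\<lambda>l. f (s (pr e l)))"
        unfolding A using * by metis
    qed
  qed
qed

text \<open>Rows are indexed by \<open>pf l\<close>, and all rows other than 0 repeat h. So not
  every function is a join; this is why reindexings below send all nonzero rows to row 1, which
  turns an arbitrary f into the join of its rows 0 and 1.\<close>

definition fjoin :: "(nat \<Rightarrow> nat) \<Rightarrow> (nat \<Rightarrow> nat) \<Rightarrow> nat \<Rightarrow> nat" where
  "fjoin f h l = (if pf l = 0 then f (ps l) else h (ps l))"

definition S11 :: "(nat \<Rightarrow> nat) \<Rightarrow> 'a presentation \<Rightarrow> (nat \<Rightarrow> 'a \<Rightarrow> (nat \<Rightarrow> nat) \<Rightarrow> bool) \<Rightarrow> bool" where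
  "S11 \<zeta> P A \<longleftrightarrow> (\<exists>B. O01 \<zeta> P B \<and> (\<forall>e z f. A e z f \<longleftrightarrow> (\<exists>h. \<not> B e z (fjoin f h))))"

lemma S11I: "O01 \<zeta> P B \<Longrightarrow> (\<And>e z f. A e z f \<longleftrightarrow> (\<exists>h. \<not> B e z (fjoin f h))) \<Longrightarrow> S11 \<zeta> P A"
  unfolding S11_def by blast

lemma S11E:
  assumes "S11 \<zeta> P A"
  obtains B where "O01 \<zeta> P B" "\<And>e z f. A e z f \<longleftrightarrow> (\<exists>h. \<not> B e z (fjoin f h))"
  using assms unfolding S11_def by blast

lemma S11_cong: "S11 \<zeta> P A \<Longrightarrow> (\<And>e z f. A e z f = B e z f) \<Longrightarrow> S11 \<zeta> P B"
  by (rule back_subst[of "S11 \<zeta> P" A]) (auto intro!: ext)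

lemma S11_not_O01:
  assumes "O01 \<zeta> P B"
  shows "S11 \<zeta> P (\<lambda>e z f. \<not> B e z f)"
proof (rule S11I)
  show "O01 \<zeta> P (\<lambda>e z f. B e z (\<lambda>l. f (pr 0 (ps (pr e l)))))"
    by (rule O01_fun[OF assms]) (intro crec_intros)
qed (simp add: fjoin_def)

lemma S11_ex_not_O01:
  assumes "O01 \<zeta> P B"
  shows "S11 \<zeta> P (\<lambda>e z f. \<exists>h. \<not> B e z h)"
proof (rule S11I)
  show "O01 \<zeta> P (\<lambda>e z f. B e z (\<lambda>l. f (pr 1 (ps (pr e l)))))"
    by (rule O01_fun[OF assms]) (intro crec_intros)
qed (simp add: fjoin_def)

lemma S11_subst:
  assumes "S11 \<zeta> P A" "crec \<zeta> s"
  shows "S11 \<zeta> P (\<lambda>e z f. A (s e) z f)"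
proof -
  from assms(1) obtain B where B: "O01 \<zeta> P B" and A: "\<And>e z f. A e z f \<longleftrightarrow> (\<exists>h. \<not> B e z (fjoin f h))"
    by (rule S11E) blast
  show ?thesis
    by (rule S11I[OF O01_subst[OF B assms(2)]]) (rule A)
qed

lemma S11_value:
  assumes "S11 \<zeta> P A" "crec \<zeta> t"
  shows "S11 \<zeta> P (\<lambda>e z f. A (pr e (f (t e))) z f)"
proof -
  from assms(1) obtain B where B: "O01 \<zeta> P B" and A: "\<And>e z f. A e z f \<longleftrightarrow> (\<exists>h. \<not> B e z (fjoin f h))"
    by (rule S11E) blast
  show ?thesis
  proof (rule S11I)
    show "O01 \<zeta> P (\<lambda>e z f. B (pr e (f (pr 0 (t e)))) z f)"
      by (rule O01_value[OF B]) (intro crec_intros assms(2))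
  qed (simp add: A fjoin_def)
qed

lemma S11_fun:
  assumes "S11 \<zeta> P A" "crec \<zeta> s"
  shows "S11 \<zeta> P (\<lambda>e z f. A e z (\<lambda>l. f (s (pr e l))))"
proof -
  from assms(1) obtain B where B: "O01 \<zeta> P B" and A: "\<And>e z f. A e z f \<longleftrightarrow> (\<exists>h. \<not> B e z (fjoin f h))"
    by (rule S11E) blast
  \<comment> \<open>Only the row of the parameter f is reindexed; the row of the witness h passes
    unchanged.\<close>
  let ?s = "\<lambda>l. if pf (ps l) = 0 then pr 0 (s (pr (pf l) (ps (ps l)))) else ps l"
  show ?thesis
  proof (rule S11I)
    show "O01 \<zeta> P (\<lambda>e z f. B e z (\<lambda>l. f (?s (pr e l))))"
      by (rule O01_fun[OF B]) (intro crec_intros crec_comp[OF assms(2)])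
  next
    fix e z f
    have "fjoin (\<lambda>l. f (s (pr e l))) h = (\<lambda>l. fjoin f h (?s (pr e l)))" for h
      by (auto simp: fjoin_def)
    then show "A e z (\<lambda>l. f (s (pr e l))) \<longleftrightarrow> (\<exists>h. \<not> B e z (\<lambda>l. fjoin f h (?s (pr e l))))"
      by (simp add: A)
  qed
qed

lemma S11_if:
  assumes "crecp \<zeta> R" "S11 \<zeta> P A" "S11 \<zeta> P A'"
  shows "S11 \<zeta> P (\<lambda>e z f. if R e then A e z f else A' e z f)"
proof -
  from assms(2) obtain B where B: "O01 \<zeta> P B" and A: "\<And>e z f. A e z f \<longleftrightarrow> (\<exists>h. \<not> B e z (fjoin f h))"
    by (rule S11E) blast
  from assms(3) obtain B' where B': "O01 \<zeta> P B'" and A': "\<And>e z f. A' e z f \<longleftrightarrow> (\<exists>h. \<not> B' e z (fjoin f h))"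
    by (rule S11E) blast
  show ?thesis
    by (rule S11I[OF O01_if[OF assms(1) B B']]) (simp add: A A')
qed

text \<open>Countable choice: the witnesses for all n are the rows of a single h, the n-th being
  \<open>\<lambda>l. h (pr n l)\<close>.\<close>

lemma S11_all:
  assumes "S11 \<zeta> P (\<lambda>e z f. A (pf e) (ps e) z f)"
  shows "S11 \<zeta> P (\<lambda>e z f. \<forall>n. A n e z f)"
proof -
  from assms obtain B where B: "O01 \<zeta> P B"
    and A: "\<And>e z f. A (pf e) (ps e) z f \<longleftrightarrow> (\<exists>h. \<not> B e z (fjoin f h))"
    by (rule S11E) blast
  have A': "A n e z f \<longleftrightarrow> (\<exists>h. \<not> B (pr n e) z (fjoin f h))" for n e z f
    using A[of "pr n e"] by simp
  \<comment> \<open>The argument will be \<open>pr (pr n e) l\<close>, so \<open>pf (pf l)\<close>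
    is the n whose row of h is to be read.\<close>
  let ?s = "\<lambda>l. if pf (ps l) = 0 then ps l else pr 1 (pr (pf (pf l)) (ps (ps l)))"
  have O: "O01 \<zeta> P (\<lambda>e z f. B e z (\<lambda>l. f (?s (pr e l))))"
    by (rule O01_fun[OF B]) (intro crec_intros)
  show ?thesis
  proof (rule S11I)
    show "O01 \<zeta> P (\<lambda>e z f. \<exists>n. B (pr n e) z (\<lambda>l. f (?s (pr (pr n e) l))))"
      by (rule O01_ex) (simp only: pr_pf_ps O)
  next
    fix e z f
    have *: "(\<lambda>l. fjoin f h (?s (pr (pr n e) l))) = fjoin f (\<lambda>l. h (pr n l))" for h n
      by (auto simp: fjoin_def)
    have "(\<forall>n. A n e z f) \<longleftrightarrow> (\<exists>h. \<forall>n. \<not> B (pr n e) z (fjoin f (\<lambda>l. h (pr n l))))"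
    proof
      assume "\<forall>n. A n e z f"
      then obtain H where H: "\<And>n. \<not> B (pr n e) z (fjoin f (H n))"
        unfolding A' by metis
      show "\<exists>h. \<forall>n. \<not> B (pr n e) z (fjoin f (\<lambda>l. h (pr n l)))"
        by (rule exI[of _ "\<lambda>l. H (pf l) (ps l)"]) (simp add: H)
    qed (auto simp: A')
    then show "(\<forall>n. A n e z f) \<longleftrightarrow> (\<exists>h. \<not> (\<exists>n. B (pr n e) z (\<lambda>l. fjoin f h (?s (pr (pr n e) l)))))"
      unfolding * by simp
  qed
qed

text \<open>Two function quantifiers contract to one whose witness has F as its row 0 and the old
  witness as its row 1. In the assumption f itself is split in this way, so that ordinary closure
  rules can establish it.\<close>

lemma S11_ex_fun:
  assumes "S11 \<zeta> P (\<lambda>e z f. A e z (\<lambda>l. f (pr 0 l)) (\<lambda>l. f (pr 1 l)))"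
  shows "S11 \<zeta> P (\<lambda>e z f. \<exists>F. A e z f F)"
proof -
  from assms obtain B where B: "O01 \<zeta> P B"
    and A: "\<And>e z f. A e z (\<lambda>l. f (pr 0 l)) (\<lambda>l. f (pr 1 l)) \<longleftrightarrow> (\<exists>h. \<not> B e z (fjoin f h))"
    by (rule S11E) blast
  have A': "A e z f F \<longleftrightarrow> (\<exists>h. \<not> B e z (fjoin (fjoin f F) h))" for e z f F
    using A[of e z "fjoin f F"] by (simp add: fjoin_def)
  let ?s = "\<lambda>l. if pf (ps l) = 0 then (if pf (ps (ps l)) = 0 then ps (ps l) else pr 1 (pr 0 (ps (ps (ps l)))))
     else pr 1 (pr 1 (ps (ps l)))"
  show ?thesis
  proof (rule S11I)
    show "O01 \<zeta> P (\<lambda>e z f. B e z (\<lambda>l. f (?s (pr e l))))"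
      by (rule O01_fun[OF B]) (intro crec_intros)
  next
    fix e z f
    have *: "(\<lambda>l. fjoin f h (?s (pr e l))) = fjoin (fjoin f (\<lambda>l. h (pr 0 l))) (\<lambda>l. h (pr 1 l))" for h
      by (auto simp: fjoin_def)
    show "(\<exists>F. A e z f F) \<longleftrightarrow> (\<exists>h. \<not> B e z (\<lambda>l. fjoin f h (?s (pr e l))))"
      unfolding * A'
    proof
      assume "\<exists>F h. \<not> B e z (fjoin (fjoin f F) h)"
      then obtain F h where "\<not> B e z (fjoin (fjoin f F) h)" by blast
      then show "\<exists>h. \<not> B e z (fjoin (fjoin f (\<lambda>l. h (pr 0 l))) (\<lambda>l. h (pr 1 l)))"
        by (intro exI[of _ "fjoin F h"]) (simp add: fjoin_def)
    qed blast
  qed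
qed

text \<open>A number quantifier is a function quantifier in which n is read off as
  \<open>F 0\<close>. The components are swapped first because \<open>S11_value\<close> appends the
  value on the right; \<open>pr 1 0\<close> is entry 0 of the row that holds F.\<close>

lemma S11_ex:
  assumes "S11 \<zeta> P (\<lambda>e z f. A (pf e) (ps e) z f)"
  shows "S11 \<zeta> P (\<lambda>e z f. \<exists>n. A n e z f)"
proof -
  have "S11 \<zeta> P (\<lambda>e z f. A (pf (pr (ps e) (pf e))) (ps (pr (ps e) (pf e))) z f)"
    by (rule S11_subst[OF assms]) (intro crec_intros)
  then have "S11 \<zeta> P (\<lambda>e z f. A (ps e) (pf e) z f)" by simp
  then have "S11 \<zeta> P (\<lambda>e z f. A (ps e) (pf e) z (\<lambda>l. f (pr 0 (ps (pr e l)))))"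
    by (rule S11_fun[where A = "\<lambda>e z f. A (ps e) (pf e) z f"]) (intro crec_intros)
  then have "S11 \<zeta> P (\<lambda>e z f. A (ps (pr e (f (pr 1 0)))) (pf (pr e (f (pr 1 0)))) z
      (\<lambda>l. f (pr 0 (ps (pr (pr e (f (pr 1 0))) l)))))"
    by (rule S11_value[where A = "\<lambda>e z f. A (ps e) (pf e) z (\<lambda>l. f (pr 0 (ps (pr e l))))"]) (intro crec_intros)
  then have "S11 \<zeta> P (\<lambda>e z f. \<exists>F::nat \<Rightarrow> nat. A (F 0) e z f)"
    by (intro S11_ex_fun[where A = "\<lambda>e z f F. A (F 0) e z f"]) simp
  then show ?thesis
  proof (rule S11_cong)
    show "(\<exists>F::nat \<Rightarrow> nat. A (F 0) e z f) = (\<exists>n. A n e z f)" for e z f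
      using exI[of "\<lambda>F. A (F 0) e z f" "\<lambda>_. n" for n] by blast
  qed
qed

text \<open>Binary connectives are number quantifiers over a case distinction at 0.\<close>

lemma S11_conj:
  assumes "S11 \<zeta> P A" "S11 \<zeta> P B"
  shows "S11 \<zeta> P (\<lambda>e z f. A e z f \<and> B e z f)"
proof (rule S11_cong)
  show "S11 \<zeta> P (\<lambda>e z f. \<forall>n. if n = (0::nat) then A e z f else B e z f)"
    by (intro S11_all S11_if S11_subst[OF assms(1)] S11_subst[OF assms(2)] crec_intros)
qed (metis zero_neq_one)

lemma S11_disj:
  assumes "S11 \<zeta> P A" "S11 \<zeta> P B"
  shows "S11 \<zeta> P (\<lambda>e z f. A e z f \<or> B e z f)"
proof (rule S11_cong)
  show "S11 \<zeta> P (\<lambda>e z f. \<exists>n. if n = (0::nat) then A e z f else B e z f)"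
    by (intro S11_ex S11_if S11_subst[OF assms(1)] S11_subst[OF assms(2)] crec_intros)
qed (metis zero_neq_one)

section \<open>Delta^1_1 relations: closure under connectives and number quantifiers\<close>

definition D11 :: "(nat \<Rightarrow> nat) \<Rightarrow> 'a presentation \<Rightarrow> (nat \<Rightarrow> 'a \<Rightarrow> (nat \<Rightarrow> nat) \<Rightarrow> bool) \<Rightarrow> bool" where
  "D11 \<zeta> P A \<longleftrightarrow> S11 \<zeta> P A \<and> S11 \<zeta> P (\<lambda>e z f. \<not> A e z f)"

named_theorems D11_intros

lemma D11_not [D11_intros]: "D11 \<zeta> P A \<Longrightarrow> D11 \<zeta> P (\<lambda>e z f. \<not> A e z f)"
  by (simp add: D11_def)

lemma D11_conj [D11_intros]: "D11 \<zeta> P A \<Longrightarrow> D11 \<zeta> P B \<Longrightarrow> D11 \<zeta> P (\<lambda>e z f. A e z f \<and> B e z f)"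
  unfolding D11_def de_Morgan_conj by (elim conjE, intro conjI S11_conj S11_disj; assumption)

lemma D11_disj [D11_intros]: "D11 \<zeta> P A \<Longrightarrow> D11 \<zeta> P B \<Longrightarrow> D11 \<zeta> P (\<lambda>e z f. A e z f \<or> B e z f)"
  unfolding D11_def de_Morgan_disj by (elim conjE, intro conjI S11_conj S11_disj; assumption)

lemma D11_imp [D11_intros]: "D11 \<zeta> P A \<Longrightarrow> D11 \<zeta> P B \<Longrightarrow> D11 \<zeta> P (\<lambda>e z f. A e z f \<longrightarrow> B e z f)"
  unfolding imp_conv_disj by (intro D11_disj D11_not)

lemma D11_iff [D11_intros]: "D11 \<zeta> P A \<Longrightarrow> D11 \<zeta> P B \<Longrightarrow> D11 \<zeta> P (\<lambda>e z f. A e z f \<longleftrightarrow> B e z f)"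
  unfolding iff_conv_conj_imp by (intro D11_conj D11_imp)

lemma D11_all [D11_intros]:
  "D11 \<zeta> P (\<lambda>e z f. A (pf e) (ps e) z f) \<Longrightarrow> D11 \<zeta> P (\<lambda>e z f. \<forall>n. A n e z f)"
  unfolding D11_def not_all by (elim conjE, intro conjI S11_all S11_ex; assumption)

lemma D11_ex [D11_intros]:
  "D11 \<zeta> P (\<lambda>e z f. A (pf e) (ps e) z f) \<Longrightarrow> D11 \<zeta> P (\<lambda>e z f. \<exists>n. A n e z f)"
  unfolding D11_def not_ex by (elim conjE, intro conjI S11_all S11_ex; assumption)

lemma D11_if [D11_intros]:
  assumes "crecp \<zeta> R" "D11 \<zeta> P A" "D11 \<zeta> P B"
  shows "D11 \<zeta> P (\<lambda>e z f. if R e then A e z f else B e z f)"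
proof -
  have "S11 \<zeta> P (\<lambda>e z f. if R e then \<not> A e z f else \<not> B e z f)"
    using assms by (intro S11_if) (simp_all add: D11_def)
  then have "S11 \<zeta> P (\<lambda>e z f. \<not> (if R e then A e z f else B e z f))"
    by (rule S11_cong) simp
  then show ?thesis using assms by (simp add: D11_def S11_if)
qed

lemma D11_subst: "D11 \<zeta> P A \<Longrightarrow> crec \<zeta> s \<Longrightarrow> D11 \<zeta> P (\<lambda>e z f. A (s e) z f)"
  unfolding D11_def by (auto intro: S11_subst)

lemma D11_value: "D11 \<zeta> P A \<Longrightarrow> crec \<zeta> t \<Longrightarrow> D11 \<zeta> P (\<lambda>e z f. A (pr e (f (t e))) z f)"
  unfolding D11_def using S11_value by blast

context presented
begin

lemma O01_crecp_pref:
  assumes "crecp \<zeta> R" "crec \<zeta> v"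
  shows "O01 \<zeta> P (\<lambda>e z f. R e \<and> pref (v e) f)"
proof -
  have "O01 \<zeta> P (\<lambda>e z f. \<exists>u. R e \<and> z \<in> U u \<and> pref (v e) f)"
    by (intro O01_ex O01_basic crecp_comp[OF assms(1)] crec_comp[OF assms(2)] crec_intros)
  then show ?thesis
    by (rule O01_cong) (use covering in auto)
qed

lemma O01_crecp: "crecp \<zeta> R \<Longrightarrow> O01 \<zeta> P (\<lambda>e z f. R e)"
  using O01_crecp_pref[of R "\<lambda>_. 0"] by (simp add: crec_const pref_def len_def)

lemma O01_pref: "crec \<zeta> v \<Longrightarrow> O01 \<zeta> P (\<lambda>e z f. pref (v e) f)"
  using O01_crecp_pref[of "\<lambda>_. True" v] crecp_eq[OF crec_const[of _ 0] crec_const[of _ 0]] by simp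

lemma D11_crecp [D11_intros]: "crecp \<zeta> R \<Longrightarrow> D11 \<zeta> P (\<lambda>e z f. R e)"
proof -
  assume R: "crecp \<zeta> R"
  have "S11 \<zeta> P (\<lambda>e z f. \<not> R e)" "S11 \<zeta> P (\<lambda>e z f. \<not> \<not> R e)"
    by (intro S11_not_O01 O01_crecp R crecp_not)+
  then show ?thesis by (simp add: D11_def)
qed

lemma D11_value_eq [D11_intros]: "crec \<zeta> t \<Longrightarrow> D11 \<zeta> P (\<lambda>e z f. f (t e) = 1)"
  using D11_value[of \<zeta> P "\<lambda>e z f. ps e = 1" t] by (simp add: D11_crecp crec_intros)

text \<open>The open matrix uses z only through membership in basic sets. After negation the point x
  occurs just in x \<notin> \<open>U u\<close>, under number quantifiers, so a Sigma^1_1 description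
  of non-membership is what has to be supplied.\<close>

lemma S11_fix_point:
  assumes "S11 \<zeta> P A" and x: "S11 \<zeta> P (\<lambda>e z f. x \<notin> U e)"
  shows "S11 \<zeta> P (\<lambda>e z f. A e x f)"
proof -
  from assms(1) obtain B where B: "O01 \<zeta> P B"
    and A: "\<And>e z f. A e z f \<longleftrightarrow> (\<exists>h. \<not> B e z (fjoin f h))"
    by (rule S11E) blast
  from B obtain Q where Q: "crecp \<zeta> Q" and BQ: "\<And>e z f. B e z f \<longleftrightarrow>
      (\<exists>v u w. pref v f \<and> Q (pr e (pr v (pr u w))) \<and> z \<in> U u)" by (rule O01E) blast
  let ?M = "\<lambda>e f. \<forall>v u w. \<not> pref v f \<or> \<not> Q (pr e (pr v (pr u w))) \<or> x \<notin> U u"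
  have nQ: "S11 \<zeta> P (\<lambda>e z f. \<not> Q e)"
    using D11_crecp[OF Q] by (simp add: D11_def)
  have M: "S11 \<zeta> P (\<lambda>e z f. ?M e f)"
    by (intro S11_all S11_disj S11_not_O01 O01_pref S11_subst[OF nQ] S11_subst[OF x] crec_intros)
  have "S11 \<zeta> P (\<lambda>e z f. \<exists>h. ?M e (fjoin f h))"
  proof (rule S11_ex_fun, rule S11_cong)
    let ?s = "\<lambda>l. if pf (ps l) = 0 then pr 0 (ps (ps l)) else pr 1 (ps (ps l))"
    show "S11 \<zeta> P (\<lambda>e z f. ?M e (\<lambda>l. f (?s (pr e l))))"
      by (rule S11_fun[OF M]) (intro crec_intros)
    show "?M e (\<lambda>l. f (?s (pr e l))) \<longleftrightarrow> ?M e (fjoin (\<lambda>l. f (pr 0 l)) (\<lambda>l. f (pr 1 l)))" for e f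
    proof -
      have "(\<lambda>l. f (?s (pr e l))) = fjoin (\<lambda>l. f (pr 0 l)) (\<lambda>l. f (pr 1 l))"
        by (auto simp: fjoin_def)
      then show ?thesis by (rule arg_cong)
    qed
  qed
  then show ?thesis by (rule S11_cong) (auto simp: A BQ)
qed

end


section \<open>The pointclasses in terms of the effective relations\<close>

text \<open>With first difference L the distance is 1 / (L + 1), which is below (m + 1) / (k + 1)
  iff k + 1 < (L + 1)(m + 1). So the ball demands agreement at the finitely many l with (l + 1)(m +
  1) \<le> k + 1.\<close>

lemma baire_ball_iff:
  "pdist baire_pres f g < rad t \<longleftrightarrow>
     (\<forall>l. Suc l * Suc (pf (ps t)) \<le> Suc (ps (ps t)) \<longrightarrow> f l = g l)"
proof (cases "f = g")
  case False
  define L where "L = (LEAST n. f n \<noteq> g n)"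
  have L: "f L \<noteq> g L" "\<And>l. l < L \<Longrightarrow> f l = g l"
    using False LeastI_ex[of "\<lambda>n. f n \<noteq> g n"] not_less_Least[of _ "\<lambda>n. f n \<noteq> g n"]
    unfolding L_def by blast+
  have "pdist baire_pres f g < rad t \<longleftrightarrow> 1 / real (Suc L) < rad t"
    using False by (simp add: baire_pres_def L_def[symmetric] add.commute)
  also have "\<dots> \<longleftrightarrow> real (Suc (ps (ps t))) < real (Suc L * Suc (pf (ps t)))"
    unfolding rad_def by (simp add: field_simps)
  also have "\<dots> \<longleftrightarrow> Suc (ps (ps t)) < Suc L * Suc (pf (ps t))"
    by (rule of_nat_less_iff)
  finally have *: "pdist baire_pres f g < rad t \<longleftrightarrow> Suc (ps (ps t)) < Suc L * Suc (pf (ps t))" .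
  show ?thesis
    unfolding *
  proof
    assume less: "Suc (ps (ps t)) < Suc L * Suc (pf (ps t))"
    show "\<forall>l. Suc l * Suc (pf (ps t)) \<le> Suc (ps (ps t)) \<longrightarrow> f l = g l"
    proof (intro allI impI)
      fix l assume "Suc l * Suc (pf (ps t)) \<le> Suc (ps (ps t))"
      then have "Suc l * Suc (pf (ps t)) < Suc L * Suc (pf (ps t))" using less by linarith
      then have "l < L" by (metis mult_less_cancel2 Suc_less_eq)
      then show "f l = g l" by (rule L)
    qed
  next
    assume "\<forall>l. Suc l * Suc (pf (ps t)) \<le> Suc (ps (ps t)) \<longrightarrow> f l = g l"
    then show "Suc (ps (ps t)) < Suc L * Suc (pf (ps t))"
      using L(1) not_less by blast
  qed
qed (simp add: baire_pres_def)

text \<open>A recursive certificate that all extensions of v lie in the ball around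
  \<open>nthc j\<close>. The bound on l follows from the inequality after it and is written to make
  the quantifier bounded.\<close>

definition in_ball :: "nat \<Rightarrow> nat \<Rightarrow> nat \<Rightarrow> bool" where
  "in_ball v j t \<longleftrightarrow> (\<forall>l<Suc (ps (ps t)). Suc l * Suc (pf (ps t)) \<le> Suc (ps (ps t)) \<longrightarrow>
     l < len v \<and> nthc v l = nthc j l)"

lemma ex_in_ball: "(\<exists>v. in_ball v j t \<and> pref v f) \<longleftrightarrow> pdist baire_pres f (nthc j) < rad t"
proof
  assume "\<exists>v. in_ball v j t \<and> pref v f"
  then obtain v where v: "in_ball v j t" "pref v f" by blast
  show "pdist baire_pres f (nthc j) < rad t"
    unfolding baire_ball_iff
  proof (intro allI impI)
    fix l assume l: "Suc l * Suc (pf (ps t)) \<le> Suc (ps (ps t))"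
    have "Suc l \<le> Suc l * Suc (pf (ps t))" by simp
    with l have "l < Suc (ps (ps t))" by linarith
    with v(1) l have "l < len v" "nthc v l = nthc j l"
      unfolding in_ball_def by blast+
    with v(2) show "f l = nthc j l" by (simp add: pref_def)
  qed
next
  assume "pdist baire_pres f (nthc j) < rad t"
  then have "in_ball (initc f (Suc (ps (ps t)))) j t"
    by (auto simp: in_ball_def baire_ball_iff)
  then show "\<exists>v. in_ball v j t \<and> pref v f" using pref_initc by blast
qed

lemma crecp_in_ball [crec_intros]:
  "crec \<zeta> v \<Longrightarrow> crec \<zeta> j \<Longrightarrow> crec \<zeta> t \<Longrightarrow> crecp \<zeta> (\<lambda>e. in_ball (v e) (j e) (t e))"
proof -
  assume *: "crec \<zeta> v" "crec \<zeta> j" "crec \<zeta> t"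
  show ?thesis
    unfolding in_ball_def by (intro crec_intros crec_comp[OF *(1)] crec_comp[OF *(2)] crec_comp[OF *(3)] *)
qed

lemma nat_ball_iff:
  "pdist nat_pres a b < rad t \<longleftrightarrow> ((a - b) + (b - a)) * Suc (ps (ps t)) < Suc (pf (ps t))"
proof -
  have "pdist nat_pres a b = real ((a - b) + (b - a))"
    \<comment> \<open>One of the two truncated differences vanishes and the other is the
      distance.\<close>
    by (cases "a \<le> b") (simp_all add: nat_pres_def dist_real_def of_nat_diff)
  then have "pdist nat_pres a b < rad t
      \<longleftrightarrow> real (((a - b) + (b - a)) * Suc (ps (ps t))) < real (Suc (pf (ps t)))"
    unfolding rad_def by (simp only: pos_less_divide_eq of_nat_0_less_iff zero_less_Suc of_nat_mult)
  then show ?thesis by (simp only: of_nat_less_iff)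
qed

lemma mem_prod_basic:
  "(x, y) \<in> basic_open (prod_pres P Q) n \<longleftrightarrow>
     pdist P x (pseq P (pf (pf n))) < rad n \<and> pdist Q y (pseq Q (ps (pf n))) < rad n"
  by (simp add: mem_basic_open prod_pres_def prod_decode_pf_ps)

lemma pseq_prod: "pseq (prod_pres P Q) n = (pseq P (pf n), pseq Q (ps n))"
  by (simp add: prod_pres_def prod_decode_pf_ps)

lemma pdist_prod: "pdist (prod_pres P Q) (x, y) (x', y') = max (pdist P x x') (pdist Q y y')"
  by (simp add: prod_pres_def)

text \<open>Both factors of a product ball share the radius of t, and \<open>rad t\<close> depends
  on \<open>ps t\<close> only; so the ball in one factor is again a basic set, with its own
  center.\<close>

lemma rad_less_iff: "pdist P z (pseq P i) < rad t \<longleftrightarrow> z \<in> basic_open P (pr i (ps t))"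
  by (simp add: mem_basic_open rad_def)

context presented
begin

lemma Sigma01_O01:
  assumes "O01 \<zeta> P A"
  shows "Sigma01 \<zeta> (prod_pres P baire_pres) {(z, f). A 0 z f}"
proof -
  from assms obtain Q where Q: "crecp \<zeta> Q" and A: "\<And>e z f. A e z f \<longleftrightarrow>
      (\<exists>v u w. pref v f \<and> Q (pr e (pr v (pr u w))) \<and> z \<in> U u)" by (rule O01E) blast
  \<comment> \<open>A ball t is listed if one witness q, made of v, u and w, is valid on all of it:
    its first factor lies formally in \<open>U u\<close>, and its Baire factor fixes the first
    \<open>len v\<close> values to those of v.\<close>
  let ?R = "\<lambda>t q. Q (pr 0 q) \<and> finc P (pr (pf (pf t)) (ps t)) (pf (ps q)) \<and>
    (\<forall>l<len (pf q). Suc l * Suc (pf (ps t)) \<le> Suc (ps (ps t)) \<and> nthc (pf q) l = nthc (ps (pf t)) l)"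
  have "re_in \<zeta> {t. \<exists>q. ?R t q}"
    by (rule re_in_crecp) (intro crec_intros crecp_comp[OF Q])
  moreover have "{(z, f). A 0 z f} = (\<Union>t\<in>{t. \<exists>q. ?R t q}. basic_open (prod_pres P baire_pres) t)"
  proof (intro equalityI subsetI)
    fix zf assume "zf \<in> {(z, f). A 0 z f}"
    then obtain z f v u w where zf: "zf = (z, f)"
      and *: "pref v f" "Q (pr 0 (pr v (pr u w)))" "z \<in> U u"
      by (auto simp: A)
    \<comment> \<open>The common radius 1 / (k + 1) must suit both factors: formally inside
      \<open>U u\<close> for z, and \<open>len v\<close> \<le> k so that the Baire ball fixes every
      value listed in v.\<close>
    from small_basic[OF *(3) open_UNIV UNIV_I, of "len v"] obtain k i
      where k: "k \<ge> len v" and i: "z \<in> U (pr i (pr 0 k))" "finc P (pr i (pr 0 k)) u" by blast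
    let ?j = "initc f (Suc k)"
    let ?t = "pr (pr i ?j) (pr 0 k)"
    have "?R ?t (pr v (pr u w))" using * k i by (auto simp: pref_def)
    moreover have "pdist baire_pres f (nthc ?j) < rad ?t"
      unfolding baire_ball_iff by simp
    then have "zf \<in> basic_open (prod_pres P baire_pres) ?t"
      using i(1) by (simp add: zf mem_prod_basic pseq_baire_pres rad_less_iff)
    ultimately show "zf \<in> (\<Union>t\<in>{t. \<exists>q. ?R t q}. basic_open (prod_pres P baire_pres) t)" by blast
  next
    fix zf assume "zf \<in> (\<Union>t\<in>{t. \<exists>q. ?R t q}. basic_open (prod_pres P baire_pres) t)"
    then obtain z f t q where zf: "zf = (z, f)" and R: "?R t q"
      and "zf \<in> basic_open (prod_pres P baire_pres) t" by (cases zf) auto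
    then have "z \<in> U (pr (pf (pf t)) (ps t))" and f: "pdist baire_pres f (nthc (ps (pf t))) < rad t"
      by (simp_all add: mem_prod_basic pseq_baire_pres rad_less_iff)
    then have "z \<in> U (pf (ps q))" using R finc_subset by blast
    moreover have "pref (pf q) f" using R f by (auto simp: pref_def baire_ball_iff)
    moreover have "Q (pr 0 (pr (pf q) (pr (pf (ps q)) (ps (ps q)))))" using R by simp
    ultimately show "zf \<in> {(z, f). A 0 z f}" using A zf by blast
  qed
  ultimately show ?thesis unfolding Sigma01_def by blast
qed

lemma Sigma11_S11:
  assumes "S11 \<zeta> P A" and T: "\<And>z f. A 0 z f \<longleftrightarrow> z \<in> T"
  shows "Sigma11 \<zeta> P T"
proof -
  from assms(1) obtain B where B: "O01 \<zeta> P B" and A: "\<And>e z f. A e z f \<longleftrightarrow> (\<exists>h. \<not> B e z (fjoin f h))"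
    by (rule S11E) blast
  let ?s = "\<lambda>l. if pf (ps l) = 0 then pr 0 (ps (ps l)) else pr 1 (ps (ps l))"
  let ?B = "\<lambda>e z f. B e z (\<lambda>l. f (?s (pr e l)))"
  have "O01 \<zeta> P ?B" by (rule O01_fun[OF B]) (intro crec_intros)
  from Sigma01_O01[OF this] have "Pi01 \<zeta> (prod_pres P baire_pres) {(z, f). \<not> ?B 0 z f}"
    unfolding Pi01_def by (rule back_subst) auto
  moreover have "T = fst ` {(z, f). \<not> ?B 0 z f}"
  proof (intro equalityI subsetI)
    fix z assume "z \<in> T"
    \<comment> \<open>\<open>A 0 z f\<close> is the same for all f, so the parameter row may be
      filled with zeros.\<close>
    then obtain h where "\<not> B 0 z (fjoin (\<lambda>_. 0) h)" using T A by blast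
    moreover have "fjoin (\<lambda>_. 0) h = (\<lambda>l. fjoin (\<lambda>_. 0) h (?s (pr 0 l)))"
      by (auto simp: fjoin_def)
    ultimately have "\<not> ?B 0 z (fjoin (\<lambda>_. 0) h)" by metis
    then show "z \<in> fst ` {(z, f). \<not> ?B 0 z f}" by force
  next
    fix z assume "z \<in> fst ` {(z, f). \<not> ?B 0 z f}"
    then obtain f where f: "\<not> ?B 0 z f" by auto
    have "(\<lambda>l. f (?s (pr 0 l))) = fjoin (\<lambda>l. f (pr 0 l)) (\<lambda>l. f (pr 1 l))"
      by (auto simp: fjoin_def)
    with f have "\<not> B 0 z (fjoin (\<lambda>l. f (pr 0 l)) (\<lambda>l. f (pr 1 l)))" by metis
    then show "z \<in> T" using A T by blast
  qed
  ultimately show ?thesis unfolding Sigma11_def by blast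
qed

text \<open>The complement of the closed matrix is an effective union of balls. Its Baire factor is
  recognized from an initial segment through \<open>in_ball\<close>, its number factor by
  arithmetic.\<close>

lemma S11_Sigma11_nat:
  assumes "Sigma11 \<zeta> nat_pres S"
  shows "S11 \<zeta> P (\<lambda>e z f. e \<in> S)"
proof -
  let ?P = "prod_pres nat_pres baire_pres"
  from assms obtain C W where "re_in \<zeta> W" and C: "- C = (\<Union>t\<in>W. basic_open ?P t)" and S: "S = fst ` C"
    unfolding Sigma11_def Pi01_def Sigma01_def by blast
  then obtain R where R: "crecp \<zeta> (\<lambda>e. R (pf e) (ps e))" and W: "\<And>n. n \<in> W \<longleftrightarrow> (\<exists>m. R n m)"
    using re_inE by metis
  have R': "crecp \<zeta> (\<lambda>e. R (a e) (b e))" if "crec \<zeta> a" "crec \<zeta> b" for a b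
    using crecp_comp[OF R crec_pr[OF that]] by simp
  let ?c = "\<lambda>e t. (e - pf (pf t) + (pf (pf t) - e)) * Suc (ps (ps t)) < Suc (pf (ps t))"
  have "O01 \<zeta> P (\<lambda>e z f. \<exists>t s v. (R t s \<and> ?c e t \<and> in_ball v (ps (pf t)) t) \<and> pref v f)"
    (is "O01 _ _ ?B")
    by (intro O01_ex O01_crecp_pref crec_intros R')
  then have "S11 \<zeta> P (\<lambda>e z f. \<exists>h. \<not> ?B e z h)" by (rule S11_ex_not_O01)
  then show ?thesis
  proof (rule S11_cong)
    fix e z and f :: "nat \<Rightarrow> nat"
    have "?B e z h \<longleftrightarrow> (e, h) \<notin> C" for h
    proof -
      have "(e, h) \<notin> C \<longleftrightarrow> (\<exists>t\<in>W. (e, h) \<in> basic_open ?P t)" using C by blast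
      also have "\<dots> \<longleftrightarrow> ?B e z h"
        unfolding W mem_prod_basic pseq_baire_pres nat_ball_iff ex_in_ball[symmetric]
        by (auto simp: W Bex_def nat_pres_def)
      finally show ?thesis ..
    qed
    then show "(\<exists>h. \<not> ?B e z h) = (e \<in> S)" unfolding S by force
  qed
qed

end

text \<open>The group variable is restricted to the dense sequence, where its index is a number;
  what remains is a relation of numbers and one point of X.\<close>

lemma S11_Sigma11_prod:
  assumes "presented \<zeta> PG" "presented \<zeta> PX"
    and "Sigma11 \<zeta> (prod_pres (prod_pres PG PX) nat_pres) S"
  shows "S11 \<zeta> PX (\<lambda>e z f. ((pseq PG (pf e), z), ps e) \<in> S)"
proof -
  interpret G: presented \<zeta> PG by fact
  interpret X: presented \<zeta> PX by fact
  let ?P = "prod_pres (prod_pres (prod_pres PG PX) nat_pres) baire_pres"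
  from assms(3) obtain C W where "re_in \<zeta> W" and C: "- C = (\<Union>t\<in>W. basic_open ?P t)" and S: "S = fst ` C"
    unfolding Sigma11_def Pi01_def Sigma01_def by blast
  then obtain R where R: "crecp \<zeta> (\<lambda>e. R (pf e) (ps e))" and W: "\<And>n. n \<in> W \<longleftrightarrow> (\<exists>m. R n m)"
    using re_inE by metis
  have R': "crecp \<zeta> (\<lambda>e. R (a e) (b e))" if "crec \<zeta> a" "crec \<zeta> b" for a b
    using crecp_comp[OF R crec_pr[OF that]] by simp
  let ?c = "\<lambda>e t. (e - ps (pf (pf t)) + (ps (pf (pf t)) - e)) * Suc (ps (ps t)) < Suc (pf (ps t))"
  have "O01 \<zeta> PX (\<lambda>e z f. \<exists>t s v. (R t s \<and> G.d (G.r (pf e)) (G.r (pf (pf (pf (pf t))))) < rad t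
      \<and> ?c (ps e) t \<and> in_ball v (ps (pf t)) t)
      \<and> z \<in> X.U (pr (ps (pf (pf (pf t)))) (ps t)) \<and> pref v f)"
    (is "O01 _ _ ?B")
    by (intro O01_ex O01_basic crec_intros G.crecp_dist_rad R')
  then have "S11 \<zeta> PX (\<lambda>e z f. \<exists>h. \<not> ?B e z h)" by (rule S11_ex_not_O01)
  then show ?thesis
  proof (rule S11_cong)
    fix e z and f :: "nat \<Rightarrow> nat"
    have "?B e z h \<longleftrightarrow> (((G.r (pf e), z), ps e), h) \<notin> C" for h
    proof -
      have "(((G.r (pf e), z), ps e), h) \<notin> C \<longleftrightarrow> (\<exists>t\<in>W. (((G.r (pf e), z), ps e), h) \<in> basic_open ?P t)"
        using C by blast
      also have "\<dots> \<longleftrightarrow> ?B e z h"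
        unfolding W mem_prod_basic pseq_prod pdist_prod pseq_baire_pres max_less_iff_conj nat_ball_iff
          ex_in_ball[symmetric] rad_less_iff[of PX]
        by (auto simp: W Bex_def nat_pres_def)
      finally show ?thesis ..
    qed
    then show "(\<exists>h. \<not> ?B e z h) = (((G.r (pf e), z), ps e) \<in> S)" unfolding S by force
  qed
qed


section \<open>Category\<close>

context presented
begin

text \<open>Asking for formally smaller basic sets gives the usual notion, by
  \<open>exists_finc\<close>.\<close>

definition nowhere_dense :: "'a set \<Rightarrow> bool" where
  "nowhere_dense N \<longleftrightarrow> (\<forall>m. \<exists>m'. finc P m' m \<and> U m' \<inter> N = {})"

definition meager :: "'a set \<Rightarrow> bool" where
  "meager S \<longleftrightarrow> (\<exists>N :: nat \<Rightarrow> 'a set. (\<forall>n. nowhere_dense (N n)) \<and> S \<subseteq> (\<Union>n. N n))"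

lemma exists_finc_self: "\<exists>n. finc P n m"
  using exists_finc[OF center_mem open_UNIV UNIV_I, of m] by blast

lemma meager_subset: "meager T \<Longrightarrow> S \<subseteq> T \<Longrightarrow> meager S"
  unfolding meager_def by blast

lemma meager_nowhere_dense: "nowhere_dense S \<Longrightarrow> meager S"
  unfolding meager_def by (rule exI[of _ "\<lambda>_. S"]) auto

lemma nowhere_dense_empty: "nowhere_dense {}"
  unfolding nowhere_dense_def using exists_finc_self by simp

lemma meager_UN:
  fixes S :: "nat \<Rightarrow> 'a set"
  assumes "\<And>n. meager (S n)"
  shows "meager (\<Union>n. S n)"
proof -
  from assms obtain N :: "nat \<Rightarrow> nat \<Rightarrow> 'a set"
    where N: "\<And>n k. nowhere_dense (N n k)" "\<And>n. S n \<subseteq> (\<Union>k. N n k)"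
    unfolding meager_def by metis
  have "(\<Union>n. S n) \<subseteq> (\<Union>e. N (pf e) (ps e))"
  proof
    fix x assume "x \<in> (\<Union>n. S n)"
    then obtain n k where "x \<in> N n k" using N(2) by blast
    then have "x \<in> N (pf (pr n k)) (ps (pr n k))" by simp
    then show "x \<in> (\<Union>e. N (pf e) (ps e))" by blast
  qed
  with N(1) show ?thesis unfolding meager_def by (intro exI[of _ "\<lambda>e. N (pf e) (ps e)"]) blast
qed

lemma meager_Un: "meager S \<Longrightarrow> meager T \<Longrightarrow> meager (S \<union> T)"
  by (rule meager_subset[OF meager_UN[of "\<lambda>n. if n = 0 then S else T"]]) (auto split: if_splits)

text \<open>Baire category theorem: the basic sets that miss a nowhere dense set have an open dense
  union, and a nonempty open set meets the intersection of countably many of these.\<close>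

lemma not_meager_basic: "\<not> meager (U m)"
proof
  assume "meager (U m)"
  then obtain N :: "nat \<Rightarrow> 'a set" where N: "\<And>n. nowhere_dense (N n)" "U m \<subseteq> (\<Union>n. N n)"
    unfolding meager_def by blast
  define T where "T n = \<Union>{U k | k. U k \<inter> N n = {}}" for n
  have op: "open (T n)" for n
    unfolding T_def by (rule open_Union) auto
  have dens: "closure (T n) = UNIV" for n
  proof (rule ccontr)
    assume "closure (T n) \<noteq> UNIV"
    then obtain x where x: "x \<in> - closure (T n)" by blast
    moreover have "open (- closure (T n))" by auto
    ultimately obtain k where k: "U k \<subseteq> - closure (T n)" using exists_basic by metis
    from N(1)[of n] obtain k' where k': "finc P k' k" "U k' \<inter> N n = {}"
      unfolding nowhere_dense_def by blast
    have "r (pf k') \<in> T n" unfolding T_def using k'(2) center_mem by blast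
    moreover have "r (pf k') \<in> U k" using finc_subset[OF k'(1)] center_mem by blast
    ultimately show False using k closure_subset by blast
  qed
  have "M.mtopology closure_of \<Inter>(range T) = UNIV"
    by (rule M.metric_Baire_category[OF mcomplete])
      (auto simp: mtopology euclidean_closure_of op dens)
  then have "closure (\<Inter>(range T)) = UNIV"
    by (simp add: mtopology euclidean_closure_of)
  then have "U m \<inter> \<Inter>(range T) \<noteq> {}"
    using open_Int_closure_eq_empty[OF open_basic[of m], of "\<Inter>(range T)"] center_mem by auto
  then show False using N(2) unfolding T_def by blast
qed

section \<open>Comeagerness in a basic set and the Baire property\<close>

definition comeager_in :: "nat \<Rightarrow> 'a set \<Rightarrow> bool" where
  "comeager_in m S \<longleftrightarrow> meager (U m - S)"

lemma comeager_in_Compl: "comeager_in m (- S) \<longleftrightarrow> meager (U m \<inter> S)"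
  by (simp add: comeager_in_def Diff_Compl)

lemma comeager_in_mono: "comeager_in m S \<Longrightarrow> S \<subseteq> T \<Longrightarrow> comeager_in m T"
  unfolding comeager_in_def by (erule meager_subset) blast

text \<open>The basic sets in which S is comeager are countably many, so their union contributes a
  meager error; the part E of \<open>U m\<close> outside that union is nowhere dense by
  assumption.\<close>

lemma comeager_in_local:
  assumes "\<And>m'. finc P m' m \<Longrightarrow> \<exists>m''. finc P m'' m' \<and> comeager_in m'' S"
  shows "comeager_in m S"
proof -
  define E where "E = U m - \<Union>{U k | k. comeager_in k S}"
  have "nowhere_dense E"
    unfolding nowhere_dense_def
  proof
    fix k
    show "\<exists>m'. finc P m' k \<and> U m' \<inter> E = {}"
    proof (cases "U k \<inter> U m = {}")
      case True
      then show ?thesis using exists_finc_self[of k] finc_subset unfolding E_def by blast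
    next
      case False
      then obtain x where x: "x \<in> U k" "x \<in> U m" by blast
      \<comment> \<open>Formal inclusion depends on codes, so k and m are served separately: k1 lies
        in \<open>U k\<close> and formally below m, where the assumption applies; afterwards m' lies
        in \<open>U k2\<close> and formally below k.\<close>
      from exists_finc[OF x(2) open_basic x(1)] obtain k1 where k1: "U k1 \<subseteq> U k" "finc P k1 m" by metis
      from assms[OF k1(2)] obtain k2 where k2: "finc P k2 k1" "comeager_in k2 S" by blast
      have "r (pf k2) \<in> U k" using center_mem k1(1) finc_subset[OF k2(1)] by blast
      from exists_finc[OF this open_basic center_mem] obtain m' where "U m' \<subseteq> U k2" "finc P m' k" by metis
      then show ?thesis using k2(2) unfolding E_def by blast
    qed
  qed
  moreover have "meager (\<Union>k. if comeager_in k S then U k - S else {})"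
    by (rule meager_UN) (auto simp: comeager_in_def meager_nowhere_dense nowhere_dense_empty)
  ultimately have "meager (E \<union> (\<Union>k. if comeager_in k S then U k - S else {}))"
    by (rule meager_Un[OF meager_nowhere_dense])
  then show ?thesis
    unfolding comeager_in_def by (rule meager_subset) (auto simp: E_def comeager_in_def)
qed

text \<open>A local form of the Baire property, in terms of basic open sets only.\<close>

definition baire_prop :: "'a set \<Rightarrow> bool" where
  "baire_prop S \<longleftrightarrow> (\<forall>m. comeager_in m (- S) \<or> (\<exists>m'. finc P m' m \<and> comeager_in m' S))"

lemma baire_prop_open:
  assumes "open S"
  shows "baire_prop S"
  unfolding baire_prop_def
proof
  fix m
  show "comeager_in m (- S) \<or> (\<exists>m'. finc P m' m \<and> comeager_in m' S)"
  proof (cases "U m \<inter> S = {}")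
    case True
    then show ?thesis
      by (simp add: comeager_in_def meager_nowhere_dense nowhere_dense_empty)
  next
    case False
    then obtain x where "x \<in> U m" "x \<in> S" by blast
    from exists_finc[OF this(1) assms this(2)] obtain m' where "U m' \<subseteq> S" "finc P m' m" by metis
    moreover from this(1) have "U m' - S = {}" by blast
    ultimately show ?thesis
      unfolding comeager_in_def by (metis meager_nowhere_dense nowhere_dense_empty)
  qed
qed

text \<open>If the complement of S is comeager nowhere formally below m, the dichotomy for S makes S
  comeager densely often below m, and \<open>comeager_in_local\<close> adds this up.\<close>

lemma baire_prop_Compl:
  assumes "baire_prop S"
  shows "baire_prop (- S)"
  unfolding baire_prop_def
proof
  fix m
  show "comeager_in m (- (- S)) \<or> (\<exists>m'. finc P m' m \<and> comeager_in m' (- S))"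
    using assms comeager_in_local[of m S] unfolding baire_prop_def by (metis double_complement)
qed

lemma baire_prop_UN:
  fixes S :: "nat \<Rightarrow> 'a set"
  assumes "\<And>n. baire_prop (S n)"
  shows "baire_prop (\<Union>n. S n)"
  unfolding baire_prop_def
proof
  fix m
  show "comeager_in m (- (\<Union>n. S n)) \<or> (\<exists>m'. finc P m' m \<and> comeager_in m' (\<Union>n. S n))"
  proof (cases "\<exists>n m'. finc P m' m \<and> comeager_in m' (S n)")
    case True
    then show ?thesis by (meson UN_upper UNIV_I comeager_in_mono)
  next
    case False
    then have "meager (U m \<inter> S n)" for n
      using assms[of n] by (auto simp: baire_prop_def comeager_in_def Diff_Compl)
    then have "meager (\<Union>n. U m \<inter> S n)" by (rule meager_UN)
    then have "meager (U m - (- (\<Union>n. S n)))" by (rule meager_subset) blast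
    then show ?thesis by (simp only: comeager_in_def simp_thms)
  qed
qed

end


section \<open>Back-and-forth relations of an action\<close>

text \<open>For a well-founded L this guarantees that b has rank at least \<gamma>, without
  computing ranks in L.\<close>

definition embeds_below :: "(nat \<Rightarrow> nat \<Rightarrow> bool) \<Rightarrow> (nat \<times> nat) set \<Rightarrow> nat \<Rightarrow> bool" where
  "embeds_below L \<gamma> b \<longleftrightarrow> (\<exists>f. (\<forall>u\<in>Field \<gamma>. L (f u) b) \<and> (\<forall>u v. (u, v) \<in> \<gamma> \<longrightarrow> u \<noteq> v \<longrightarrow> L (f u) (f v)))"

text \<open>A smaller ordinal is isomorphic to the predecessors of some a in \<gamma>, and the image
  of a under the embedding serves as c.\<close>

lemma embeds_below_ordLess:
  assumes "embeds_below L \<gamma> b" "(\<beta>, \<gamma>) \<in> ordLess"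
  obtains c where "L c b" "embeds_below L \<beta> c"
proof -
  from assms(1) obtain f where f: "\<And>u. u \<in> Field \<gamma> \<Longrightarrow> L (f u) b"
    "\<And>u v. (u, v) \<in> \<gamma> \<Longrightarrow> u \<noteq> v \<Longrightarrow> L (f u) (f v)"
    unfolding embeds_below_def by blast
  have "Well_order \<gamma>" "Well_order \<beta>" using assms(2) by (auto simp: ordLess_def)
  with assms(2) obtain a where a: "a \<in> Field \<gamma>" "(\<beta>, Restr \<gamma> (underS \<gamma> a)) \<in> ordIso"
    using ordLess_iff_ordIso_Restr by blast
  let ?R = "Restr \<gamma> (underS \<gamma> a)"
  from a(2) obtain h where "iso \<beta> ?R h" unfolding ordIso_def by blast
  then have h: "bij_betw h (Field \<beta>) (Field ?R)"
    "\<And>u v. u \<in> Field \<beta> \<Longrightarrow> v \<in> Field \<beta> \<Longrightarrow> (u, v) \<in> \<beta> \<longleftrightarrow> (h u, h v) \<in> ?R"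
    unfolding iso_iff2 by blast+
  have "embeds_below L \<beta> (f a)"
    unfolding embeds_below_def
  proof (intro exI[of _ "f \<circ> h"] conjI ballI allI impI)
    fix u assume "u \<in> Field \<beta>"
    then have "h u \<in> Field ?R" using h(1) by (auto simp: bij_betw_def)
    then have "h u \<in> underS \<gamma> a" by (auto simp: Field_def)
    then show "L ((f \<circ> h) u) (f a)" using f(2) by (auto simp: underS_def)
  next
    fix u v assume uv: "(u, v) \<in> \<beta>" "u \<noteq> v"
    then have "u \<in> Field \<beta>" "v \<in> Field \<beta>" by (auto simp: Field_def)
    with uv h have "(h u, h v) \<in> \<gamma>" "h u \<noteq> h v" by (auto simp: bij_betw_def inj_on_def)
    then show "L ((f \<circ> h) u) ((f \<circ> h) v)" using f(2) by simp
  qed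
  with f(1)[OF a(1)] show thesis by (rule that)
qed

locale presented_action = G: presented \<zeta> PG + X: presented \<zeta> PX
  for \<zeta> and PG :: "'g::topological_group_add presentation"
    and PX :: "'x::topological_space presentation" +
  fixes act :: "'g \<Rightarrow> 'x \<Rightarrow> 'x"
  assumes action: "continuous_action act"
begin

abbreviation "V \<equiv> G.U"

lemma act_0 [simp]: "act 0 x = x" and act_add: "act (g + h) x = act g (act h x)"
  using action by (auto simp: continuous_action_def)

lemma open_act: "open S \<Longrightarrow> open {g. act g x \<in> S}"
proof -
  assume S: "open S"
  have "continuous_on UNIV (\<lambda>(g, x). act g x)" using action by (simp add: continuous_action_def)
  then have "continuous_on UNIV (\<lambda>g. (\<lambda>(g, x). act g x) (g, x))"
    by (rule continuous_on_compose2) (auto intro!: continuous_intros)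
  then have "open ((\<lambda>g. act g x) -` S)" using S by (simp add: open_vimage)
  then show ?thesis by (simp add: vimage_def)
qed

lemma baire_prop_Sigma0: "Sigma0 \<gamma> A \<Longrightarrow> G.baire_prop {g. act g x \<in> A}"
proof (induction rule: Sigma0.induct)
  case (Sigma0_one A a)
  then show ?case by (intro G.baire_prop_open open_act)
next
  case (Sigma0_union \<beta> \<alpha> A)
  have "G.baire_prop (- {g. act g x \<in> - A n})" for n
    using Sigma0_union by (intro G.baire_prop_Compl) blast
  then have "G.baire_prop (\<Union>n. - {g. act g x \<in> - A n})" by (rule G.baire_prop_UN)
  then show ?case by (rule back_subst[of G.baire_prop]) auto
qed

text \<open>By continuity this says that V_m x lies in the closure of V_n y. Dense points keep all
  quantifiers numerical.\<close>

definition same_hits :: "'x \<Rightarrow> nat \<Rightarrow> 'x \<Rightarrow> nat \<Rightarrow> bool" where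
  "same_hits x m y n \<longleftrightarrow> (\<forall>k. (\<exists>i. G.r i \<in> V m \<and> act (G.r i) x \<in> X.U k) \<longrightarrow>
     (\<exists>j. G.r j \<in> V n \<and> act (G.r j) y \<in> X.U k))"

inductive bf :: "(nat \<Rightarrow> nat \<Rightarrow> bool) \<Rightarrow> nat \<Rightarrow> 'x \<Rightarrow> nat \<Rightarrow> 'x \<Rightarrow> nat \<Rightarrow> bool" for L where
  bfI: "same_hits x m y n \<Longrightarrow>
    (\<And>c m'. L c b \<Longrightarrow> finc PG m' m \<Longrightarrow> \<exists>n'. finc PG n' n \<and> bf L c y n' x m') \<Longrightarrow> bf L b x m y n"

lemma bf_iff:
  "bf L b x m y n \<longleftrightarrow> same_hits x m y n \<and>
     (\<forall>c. L c b \<longrightarrow> (\<forall>m'. finc PG m' m \<longrightarrow> (\<exists>n'. finc PG n' n \<and> bf L c y n' x m')))"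
  by (subst bf.simps) blast

lemma same_hits_open:
  assumes "same_hits x m y n" "open S" "g \<in> V m" "act g x \<in> S"
  obtains h where "h \<in> V n" "act h y \<in> S"
proof -
  from X.exists_basic[OF assms(2,4)] obtain k where k: "act g x \<in> X.U k" "X.U k \<subseteq> S" .
  have "open (V m \<inter> {g. act g x \<in> X.U k})" by (intro open_Int open_act) simp_all
  then obtain i where "G.r i \<in> V m \<inter> {g. act g x \<in> X.U k}"
    by (rule G.dense_meets[where x = g]) (use assms(3) k(1) in blast)
  then obtain j where "G.r j \<in> V n" "act (G.r j) y \<in> X.U k"
    using assms(1) unfolding same_hits_def by blast
  with k(2) that show thesis by blast
qed

lemma bf_refl:
  assumes "wfP L"
  shows "bf L b x m x m"
  using assms
proof (induction b arbitrary: m rule: wfp_induct_rule)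
  case (less b)
  show ?case by (rule bfI) (use less in \<open>auto simp: same_hits_def\<close>)
qed

text \<open>V_m' acting on g x is V_m' g acting on x. Translates of basic sets need not be basic, so
  only inclusions are asked: the left neighbourhood may shrink and the right one may grow.\<close>

lemma bf_translate:
  "bf L b x m y n \<Longrightarrow> \<forall>v\<in>V m'. v + g \<in> V m \<Longrightarrow> \<forall>v\<in>V n. v - h \<in> V n'
    \<Longrightarrow> bf L b (act g x) m' (act h y) n'"
proof (induction arbitrary: g h m' n' rule: bf.induct)
  case (bfI x m y n b)
  show ?case
  proof (rule bf.bfI)
    show "same_hits (act g x) m' (act h y) n'"
      unfolding same_hits_def
    proof (intro allI impI)
      fix k assume "\<exists>i. G.r i \<in> V m' \<and> act (G.r i) (act g x) \<in> X.U k"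
      then obtain v where "v \<in> V m" "act v x \<in> X.U k" using bfI.prems(1) by (auto simp: act_add)
      with bfI.hyps(1) obtain w where w: "w \<in> V n" "act w y \<in> X.U k"
        by (rule same_hits_open[OF _ X.open_basic])
      have "act (w - h) (act h y) = act w y" by (simp add: act_add[symmetric])
      then have "w - h \<in> V n' \<inter> {v. act v (act h y) \<in> X.U k}" using w bfI.prems(2) by simp
      moreover have "open (V n' \<inter> {v. act v (act h y) \<in> X.U k})" by (intro open_Int open_act) simp_all
      ultimately obtain j where "G.r j \<in> V n' \<inter> {v. act v (act h y) \<in> X.U k}"
        using G.dense_meets by metis
      then show "\<exists>j. G.r j \<in> V n' \<and> act (G.r j) (act h y) \<in> X.U k" by blast
    qed
  next
    fix c m'' assume c: "L c b" "finc PG m'' m'"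
    \<comment> \<open>The move m'' at g x is answered through x and y: m1 is formally below m and
      inside the translate of \<open>V m''\<close> by g, its answer is n1, and n1 is translated back
      to n''.\<close>
    have "open {v. v - g \<in> V m''}"
      using open_vimage[of "V m''" "\<lambda>v. v - g"] by (simp add: vimage_def continuous_intros)
    moreover have "G.r (pf m'') + g \<in> V m"
      using G.finc_subset[OF c(2)] G.center_mem bfI.prems(1) by blast
    ultimately obtain m1 where m1: "V m1 \<subseteq> {v. v - g \<in> V m''}" "finc PG m1 m"
      using G.exists_finc[of "G.r (pf m'') + g" m "{v. v - g \<in> V m''}"] by (auto simp: G.center_mem)
    from bfI.IH[OF c(1) m1(2)] obtain n1 where n1: "finc PG n1 n"
      "\<And>g h m' n'. \<forall>v\<in>V m'. v + g \<in> V n1 \<Longrightarrow> \<forall>v\<in>V m1. v - h \<in> V n' \<Longrightarrow> bf L c (act g y) m' (act h x) n'"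
      by blast
    have "open {v. v + h \<in> V n1}"
      using open_vimage[of "V n1" "\<lambda>v. v + h"] by (simp add: vimage_def continuous_intros)
    moreover have "G.r (pf n1) - h \<in> V n'"
      using G.finc_subset[OF n1(1)] G.center_mem bfI.prems(2) by blast
    ultimately obtain n'' where n'': "V n'' \<subseteq> {v. v + h \<in> V n1}" "finc PG n'' n'"
      using G.exists_finc[of "G.r (pf n1) - h" n' "{v. v + h \<in> V n1}"] by (auto simp: G.center_mem)
    have "bf L c (act h y) n'' (act g x) m''"
      by (rule n1(2)) (use n'' m1 in auto)
    with n'' show "\<exists>n''. finc PG n'' n' \<and> bf L c (act h y) n'' (act g x) m''" by blast
  qed
qed

text \<open>For \<open>m\<close> and \<open>A\<close>, \<open>\<not> comeager_in m (- {g. act g x \<in> A})\<close> says that \<open>x\<close> lies in the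
  Vaught transform of \<open>A\<close> with respect to \<open>V m\<close>.\<close>

lemma bf_transfer:
  assumes "Sigma0 \<gamma> A" "embeds_below L \<gamma> b" "bf L b x m y n"
    "G.comeager_in n (- {g. act g y \<in> A})"
  shows "G.comeager_in m (- {g. act g x \<in> A})"
  using assms
proof (induction arbitrary: b x m y n rule: Sigma0.induct)
  case (Sigma0_one A a)
  show ?case
  proof (rule ccontr)
    assume "\<not> G.comeager_in m (- {g. act g x \<in> A})"
    then have "V m \<inter> {g. act g x \<in> A} \<noteq> {}"
      by (metis G.comeager_in_Compl G.meager_nowhere_dense G.nowhere_dense_empty)
    then obtain g where "g \<in> V m" "act g x \<in> A" by blast
    moreover have "same_hits x m y n" using Sigma0_one.prems(2) bf_iff by blast
    ultimately obtain h where h: "h \<in> V n" "act h y \<in> A"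
      using same_hits_open[OF _ Sigma0_one.hyps] by metis
    have "open (V n \<inter> {g. act g y \<in> A})" by (intro open_Int open_act Sigma0_one.hyps) simp
    with h obtain k where "V k \<subseteq> V n \<inter> {g. act g y \<in> A}" using G.exists_basic by blast
    with Sigma0_one.prems(3) show False
      unfolding G.comeager_in_Compl using G.not_meager_basic G.meager_subset by blast
  qed
next
  case (Sigma0_union \<beta> \<alpha> A)
  let ?S = "\<lambda>x n. {g. act g x \<in> A n}"
  have S: "{g. act g x \<in> (\<Union>n. A n)} = (\<Union>k. ?S x k)" for x by auto
  have "G.baire_prop (?S x k)" for k
  proof -
    have "Sigma0 (\<beta> k) (- A k)" using Sigma0_union.IH by blast
    then have "G.baire_prop (- {g. act g x \<in> - A k})" by (intro G.baire_prop_Compl baire_prop_Sigma0)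
    then show ?thesis by (rule back_subst[of G.baire_prop]) auto
  qed
  note bp = this
  show ?case
  proof (rule ccontr)
    assume *: "\<not> ?thesis"
    have "\<exists>k. \<not> G.comeager_in m (- ?S x k)"
    proof (rule ccontr)
      assume "\<not> ?thesis"
      then have "G.meager (\<Union>k. V m \<inter> ?S x k)"
        by (intro G.meager_UN) (simp add: G.comeager_in_Compl)
      then have "G.meager (V m \<inter> (\<Union>k. ?S x k))" by (rule G.meager_subset) blast
      with * show False unfolding S G.comeager_in_Compl by blast
    qed
    then obtain k where "\<not> G.comeager_in m (- ?S x k)" by blast
    \<comment> \<open>Nonmeager becomes comeager on a formally smaller basic set, which is a move
      that \<open>bf\<close> answers.\<close>
    with bp[of k] obtain m' where m': "finc PG m' m" "G.comeager_in m' (?S x k)"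
      unfolding G.baire_prop_def by blast
    have \<beta>: "(\<beta> k, \<alpha>) \<in> ordLess" using Sigma0_union.IH by blast
    with Sigma0_union.prems(1) obtain c where c: "L c b" "embeds_below L (\<beta> k) c"
      by (rule embeds_below_ordLess)
    with m' Sigma0_union.prems(2) obtain n' where n': "finc PG n' n" "bf L c y n' x m'"
      using bf_iff by blast
    have neg: "- {g. act g x \<in> - A k} = ?S x k" for x by auto
    have IH: "G.comeager_in n (- {g. act g y \<in> - A k}) \<Longrightarrow> G.comeager_in m (- {g. act g x \<in> - A k})"
      if "embeds_below L (\<beta> k) b" "bf L b x m y n" for b x m y n
      using Sigma0_union.IH that by blast
    \<comment> \<open>The complement of A k is meager for x on \<open>V m'\<close>, hence for y on
      \<open>V n'\<close>; so A k is comeager there, although the union is meager on the larger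
      \<open>V n\<close>.\<close>
    have "G.comeager_in n' (- {g. act g y \<in> - A k})"
      by (rule IH[OF c(2) n'(2)]) (use m'(2) neg in simp)
    then have "G.meager (V n' - ?S y k)"
      unfolding neg G.comeager_in_def .
    moreover have "G.meager (V n \<inter> {g. act g y \<in> (\<Union>n. A n)})"
      using Sigma0_union.prems(3) unfolding G.comeager_in_Compl .
    ultimately have "G.meager ((V n' - ?S y k) \<union> (V n \<inter> {g. act g y \<in> (\<Union>n. A n)}))"
      by (rule G.meager_Un)
    then have "G.meager (V n')"
      by (rule G.meager_subset) (use G.finc_subset[OF n'(1)] in auto)
    then show False using G.not_meager_basic by blast
  qed
qed

text \<open>The given neighbourhood stands on the right because \<open>bf_transfer\<close> carries
  meagerness from right to left. Leaving the other one free is what absorbs translations, and both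
  directions together give symmetry.\<close>

definition sim :: "(nat \<Rightarrow> nat \<Rightarrow> bool) \<Rightarrow> nat \<Rightarrow> 'x \<Rightarrow> 'x \<Rightarrow> bool" where
  "sim L b x z \<longleftrightarrow> (\<forall>m. \<exists>n. bf L b z n x m) \<and> (\<forall>m. \<exists>n. bf L b x n z m)"

lemma sim_sym: "sim L b x z \<Longrightarrow> sim L b z x"
  by (auto simp: sim_def)

lemma sim_refl: "wfP L \<Longrightarrow> sim L b x x"
  unfolding sim_def using bf_refl by blast

lemma invariantI:
  assumes "\<And>g z. z \<in> T \<Longrightarrow> act g z \<in> T"
  shows "invariant act T"
  unfolding invariant_def
proof (intro allI equalityI subsetI)
  fix g z assume "z \<in> T"
  moreover have "act g (act (- g) z) = z" by (simp add: act_add[symmetric])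
  ultimately show "z \<in> act g ` T" using assms by (metis imageI)
qed (use assms in auto)

lemma invariant_iff: "invariant act T \<Longrightarrow> act g z \<in> T \<longleftrightarrow> z \<in> T"
proof
  assume T: "invariant act T" and "act g z \<in> T"
  then have "act (- g) (act g z) \<in> T" unfolding invariant_def by blast
  then show "z \<in> T" by (simp add: act_add[symmetric])
qed (auto simp: invariant_def)

lemma invariant_sim: "invariant act {z. sim L b x z}"
proof (rule invariantI)
  fix g z assume "z \<in> {z. sim L b x z}"
  then have 1: "\<And>m. \<exists>n. bf L b z n x m" and 2: "\<And>m. \<exists>n. bf L b x n z m"
    by (auto simp: sim_def)
  have "\<exists>n. bf L b (act g z) n x m" for m
  proof -
    from 1 obtain n where n: "bf L b z n x m" by blast
    have "open {v. v + g \<in> V n}"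
      using open_vimage[of "V n" "\<lambda>v. v + g"] by (simp add: vimage_def continuous_intros)
    moreover have "G.r (pf n) - g \<in> {v. v + g \<in> V n}" by (simp add: G.center_mem)
    ultimately obtain n' where "V n' \<subseteq> {v. v + g \<in> V n}" by (rule G.exists_basic)
    then have "bf L b (act g z) n' (act 0 x) m"
      by (intro bf_translate[OF n]) auto
    then show ?thesis by auto
  qed
  moreover have "\<exists>n. bf L b x n (act g z) m" for m
  proof -
    have "open {v. v - g \<in> V m}"
      using open_vimage[of "V m" "\<lambda>v. v - g"] by (simp add: vimage_def continuous_intros)
    moreover have "G.r (pf m) + g \<in> {v. v - g \<in> V m}" by (simp add: G.center_mem)
    ultimately obtain m' where m': "V m' \<subseteq> {v. v - g \<in> V m}" by (rule G.exists_basic)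
    from 2 obtain n where n: "bf L b x n z m'" by blast
    have "bf L b (act 0 x) n (act g z) m"
      by (rule bf_translate[OF n]) (use m' in auto)
    then show ?thesis by auto
  qed
  ultimately show "act g z \<in> {z. sim L b x z}" by (simp add: sim_def)
qed

text \<open>The pieces of the top union need not be invariant, but all g send x into B, so by
  category one piece is comeager on some V_m. Only the rank of its complement has to embed into L,
  and L is picked after the piece.\<close>

lemma sim_Sigma0:
  assumes "Sigma0 \<alpha> B" and inv: "invariant act B" and "x \<in> B"
    and ex: "\<exists>L b. sim L b x z"
    and ex_less: "\<And>\<beta>. (\<beta>, \<alpha>) \<in> ordLess \<Longrightarrow> \<exists>L b. embeds_below L \<beta> b \<and> sim L b x z"
  shows "z \<in> B"
  using assms(1)
proof cases
  case (Sigma0_one a)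
  \<comment> \<open>For an open set the base clause of any one relation suffices.\<close>
  from ex obtain L b n where "bf L b x n z 0" unfolding sim_def by blast
  then have "same_hits x n z 0" using bf_iff by blast
  moreover have "act (G.r (pf n)) x \<in> B" using invariant_iff[OF inv] \<open>x \<in> B\<close> by blast
  ultimately obtain h where "act h z \<in> B"
    using same_hits_open[OF _ Sigma0_one(2) G.center_mem] by metis
  then show ?thesis using invariant_iff[OF inv] by blast
next
  case (Sigma0_union \<beta> A)
  let ?S = "\<lambda>x n. {g. act g x \<in> A n}"
  have neg: "- {g. act g x \<in> - A k} = ?S x k" for x k by auto
  have Sig: "Sigma0 (\<beta> k) (- A k)" for k using Sigma0_union by blast
  have "\<exists>k. \<not> G.meager (V 0 \<inter> ?S x k)"
  proof (rule ccontr)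
    assume "\<not> ?thesis"
    then have "G.meager (\<Union>k. V 0 \<inter> ?S x k)" by (intro G.meager_UN) blast
    moreover have "act g x \<in> (\<Union>k. A k)" for g
      using invariant_iff[OF inv] \<open>x \<in> B\<close> Sigma0_union(1) by blast
    then have "(\<Union>k. V 0 \<inter> ?S x k) = V 0" by blast
    ultimately show False using G.not_meager_basic by simp
  qed
  then obtain k where "\<not> G.comeager_in 0 (- ?S x k)"
    by (auto simp: G.comeager_in_Compl)
  moreover have "G.baire_prop (?S x k)"
    using G.baire_prop_Compl[OF baire_prop_Sigma0[OF Sig[of k]]] unfolding neg .
  ultimately obtain m where m: "G.comeager_in m (?S x k)"
    unfolding G.baire_prop_def by blast
  have "(\<beta> k, \<alpha>) \<in> ordLess" using Sigma0_union by blast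
  from ex_less[OF this] obtain L b n where L: "embeds_below L (\<beta> k) b" "bf L b z n x m"
    unfolding sim_def by blast
  have "G.comeager_in n (- {g. act g z \<in> - A k})"
    by (rule bf_transfer[OF Sig L]) (use m neg in simp)
  then have "G.meager (V n - ?S z k)" unfolding neg G.comeager_in_def .
  then obtain g where "act g z \<in> A k"
    using G.not_meager_basic G.meager_subset by blast
  then show ?thesis using invariant_iff[OF inv] Sigma0_union(1) by blast
qed

end


section \<open>The back-and-forth classes of a hyperarithmetic point are hyperarithmetic\<close>

context presented_action
begin

definition side :: "'x \<Rightarrow> 'x \<Rightarrow> nat \<Rightarrow> 'x" where
  "side x z s = (if s = 0 then x else z)"

text \<open>\<open>F\<close> at \<open>\<langle>s, \<langle>b, \<langle>m, n\<rangle>\<rangle>\<rangle>\<close> is to tell whether \<open>bf L b\<close> holds between \<open>x, z\<close> if \<open>s = 0\<close>, and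
  between \<open>z, x\<close> otherwise.\<close>

definition bf_table :: "(nat \<Rightarrow> nat \<Rightarrow> bool) \<Rightarrow> 'x \<Rightarrow> 'x \<Rightarrow> (nat \<Rightarrow> nat) \<Rightarrow> bool" where
  "bf_table L x z F \<longleftrightarrow> (\<forall>s b m n. F (pr s (pr b (pr m n))) = 1 \<longleftrightarrow>
     same_hits (side x z s) m (side x z (1 - s)) n \<and>
     (\<forall>c. L c b \<longrightarrow> (\<forall>m'. finc PG m' m \<longrightarrow>
        (\<exists>n'. finc PG n' n \<and> F (pr (1 - s) (pr c (pr n' m'))) = 1))))"

text \<open>Values other than 1 all count as false, so well-founded induction fixes which entries
  are 1, not F itself.\<close>

lemma bf_table_unique:
  assumes "wfP L" "bf_table L x z F"
  shows "F (pr s (pr b (pr m n))) = 1 \<longleftrightarrow> bf L b (side x z s) m (side x z (1 - s)) n"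
  using assms(1)
proof (induction b arbitrary: s m n rule: wfp_induct_rule)
  case (less b)
  \<comment> \<open>s is any number: for s > 1 the truncated \<open>1 - (1 - s)\<close> is 1 and not
    s, but \<open>side\<close> asks only whether it is 0.\<close>
  have "side x z (1 - (1 - s)) = side x z s" by (simp add: side_def)
  then have "F (pr (1 - s) (pr c (pr n' m'))) = 1 \<longleftrightarrow> bf L c (side x z (1 - s)) n' (side x z s) m'"
    if "L c b" for c n' m' using less[OF that, of "1 - s" n' m'] by simp
  then show ?case
    using assms(2)[unfolded bf_table_def, rule_format, of s b m n] unfolding bf_iff[of L b] by auto
qed

lemma bf_table_exists: "\<exists>F. bf_table L x z F"
proof
  define F where "F e = (if bf L (pf (ps e)) (side x z (pf e)) (pf (ps (ps e))) (side x z (1 - pf e)) (ps (ps (ps e)))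
    then 1 else 0 :: nat)" for e
  have F: "F (pr s (pr b (pr m n))) = 1 \<longleftrightarrow> bf L b (side x z s) m (side x z (1 - s)) n" for s b m n
    by (simp add: F_def)
  have "side x z (1 - (1 - s)) = side x z s" for s by (simp add: side_def)
  then show "bf_table L x z F"
    unfolding bf_table_def F by (intro allI) (simp only: bf_iff[symmetric])
qed

definition table_sim :: "nat \<Rightarrow> (nat \<Rightarrow> nat) \<Rightarrow> bool" where
  "table_sim b F \<longleftrightarrow> (\<forall>m. \<exists>n. F (pr 1 (pr b (pr n m))) = 1) \<and> (\<forall>m. \<exists>n. F (pr 0 (pr b (pr n m))) = 1)"

lemma table_sim_iff: "wfP L \<Longrightarrow> bf_table L x z F \<Longrightarrow> table_sim b F \<longleftrightarrow> sim L b x z"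
  by (simp only: table_sim_def sim_def bf_table_unique) (simp add: side_def)

lemma D11_act:
  assumes "hyp_fun \<zeta> (prod_pres PG PX) PX (\<lambda>(g, z). act g z)"
  shows "D11 \<zeta> PX (\<lambda>e z f. act (G.r (pf e)) z \<in> X.U (ps e))"
proof -
  let ?S = "{(y, n). (\<lambda>(g, z). act g z) y \<in> X.U n}"
  have "Sigma11 \<zeta> (prod_pres (prod_pres PG PX) nat_pres) ?S"
    and "Sigma11 \<zeta> (prod_pres (prod_pres PG PX) nat_pres) (- ?S)"
    using assms unfolding hyp_fun_def hyp_set_def Pi11_def by auto
  from this[THEN S11_Sigma11_prod[OF G.presented_axioms X.presented_axioms]]
  show ?thesis unfolding D11_def by simp
qed

lemma D11_point:
  assumes "hyp_point \<zeta> PX x"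
  shows "D11 \<zeta> PX (\<lambda>e z f. x \<in> X.U e)"
  using assms X.S11_Sigma11_nat[of "{n. x \<in> X.U n}"] X.S11_Sigma11_nat[of "- {n. x \<in> X.U n}"]
  unfolding D11_def hyp_point_def hyp_set_def Pi11_def by simp

text \<open>Fixing the point variable at x goes through \<open>S11_fix_point\<close> twice, for the
  relation and for its negation.\<close>

lemma D11_act_side:
  assumes "hyp_fun \<zeta> (prod_pres PG PX) PX (\<lambda>(g, z). act g z)" "hyp_point \<zeta> PX x"
    and "crec \<zeta> s" "crec \<zeta> i" "crec \<zeta> k"
  shows "D11 \<zeta> PX (\<lambda>e z f. act (G.r (i e)) (side x z (s e)) \<in> X.U (k e))"
proof -
  note D = D11_act[OF assms(1)]
  have not_x: "S11 \<zeta> PX (\<lambda>e z f. x \<notin> X.U e)" using D11_point[OF assms(2)] by (simp add: D11_def)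
  have Dx: "D11 \<zeta> PX (\<lambda>e z f. act (G.r (pf e)) x \<in> X.U (ps e))"
    using D X.S11_fix_point[OF _ not_x, of "\<lambda>e z f. act (G.r (pf e)) z \<in> X.U (ps e)"]
      X.S11_fix_point[OF _ not_x, of "\<lambda>e z f. act (G.r (pf e)) z \<notin> X.U (ps e)"]
    unfolding D11_def by simp
  have "D11 \<zeta> PX (\<lambda>e z f. if s e = 0 then act (G.r (pf (pr (i e) (k e)))) x \<in> X.U (ps (pr (i e) (k e)))
      else act (G.r (pf (pr (i e) (k e)))) z \<in> X.U (ps (pr (i e) (k e))))"
    by (intro D11_if D11_subst[OF Dx] D11_subst[OF D] crec_intros assms)
  then show ?thesis by (rule back_subst[of "D11 \<zeta> PX"]) (auto simp: side_def intro!: ext)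
qed

text \<open>Being a table takes number quantifiers only. All tables give \<open>table_sim\<close>
  the same answer, so the complement too asks for just one table, with the opposite answer.\<close>

lemma hyp_set_sim:
  assumes "hyp_fun \<zeta> (prod_pres PG PX) PX (\<lambda>(g, z). act g z)" "hyp_point \<zeta> PX x"
    and "wfP L" and L: "crecp \<zeta> (\<lambda>e. L (pf e) (ps e))"
  shows "hyp_set \<zeta> PX {z. sim L b x z}"
proof -
  have L': "crecp \<zeta> (\<lambda>e. L (a e) (c e))" if "crec \<zeta> a" "crec \<zeta> c" for a c
    using crecp_comp[OF L crec_pr[OF that]] by simp
  have table: "D11 \<zeta> PX (\<lambda>e z f. bf_table L x z (\<lambda>l. f (pr 1 l)))"
    unfolding bf_table_def same_hits_def
    by (intro D11_intros D11_act_side[OF assms(1,2)] X.D11_crecp L' crec_intros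
        G.crecp_finc G.crecp_mem_basic)
  have final: "D11 \<zeta> PX (\<lambda>e z f. table_sim b (\<lambda>l. f (pr 1 l)))"
    unfolding table_sim_def by (intro D11_intros X.D11_value_eq crec_intros)
  have "Sigma11 \<zeta> PX {z. sim L b x z}"
  proof (rule X.Sigma11_S11)
    show "S11 \<zeta> PX (\<lambda>e z f. \<exists>F. bf_table L x z F \<and> table_sim b F)"
      by (rule S11_ex_fun) (use table final in \<open>simp add: D11_def S11_conj\<close>)
  qed (use table_sim_iff[OF \<open>wfP L\<close>] bf_table_exists[of L x] in blast)
  moreover have "Sigma11 \<zeta> PX (- {z. sim L b x z})"
  proof (rule X.Sigma11_S11)
    show "S11 \<zeta> PX (\<lambda>e z f. \<exists>F. bf_table L x z F \<and> \<not> table_sim b F)"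
      by (rule S11_ex_fun) (use table final in \<open>simp add: D11_def S11_conj\<close>)
  qed (use table_sim_iff[OF \<open>wfP L\<close>] bf_table_exists[of L x] in blast)
  ultimately show ?thesis by (simp add: hyp_set_def Pi11_def)
qed

end

text \<open>Shifts a recursive well-order by one and uses \<open>0\<close> as a new greatest element.\<close>

lemma recursive_ordinal_embeds_below:
  assumes "recursive_ordinal \<zeta> \<beta>"
  obtains L where "wfP L" "crecp \<zeta> (\<lambda>e. L (pf e) (ps e))" "embeds_below L \<beta> 0"
proof -
  from assms obtain r :: "(nat \<times> nat) set" where r: "(r, \<beta>) \<in> ordIso"
    and rec: "rec_rel \<zeta> 2 (\<lambda>xs. (xs ! 0, xs ! 1) \<in> r)"
    unfolding recursive_ordinal_def by blast
  have wo: "Well_order r" "Well_order \<beta>" using r by (auto simp: ordIso_def)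
  \<comment> \<open>Every c \<noteq> 0 lies below 0, also if c - 1 is outside the field of r; such a
    c has no predecessors.\<close>
  define L where "L c b \<longleftrightarrow> c \<noteq> 0 \<and> (b = 0 \<or> c \<noteq> b \<and> (c - 1, b - 1) \<in> r)" for c b :: nat
  have rel: "crecp \<zeta> (\<lambda>e. (a e, b e) \<in> r)" if "crec \<zeta> a" "crec \<zeta> b" for a b
    using crecp_rec_rel2[OF rec that] by simp
  have "wf (r - Id)" using wo(1) by (simp add: well_order_on_def)
  \<comment> \<open>The first component is 1 at 0 only, which puts 0 on top; elsewhere the strict
    part of r decides.\<close>
  then have "wf (inv_image (less_than <*lex*> (r - Id)) (\<lambda>c. (if c = 0 then 1 else 0 :: nat, c - 1)))"
    by (intro wf_inv_image wf_lex_prod wf_less_than)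
  then have "wfP L"
    unfolding wfp_def by (rule wf_subset) (auto simp: L_def)
  moreover have "crecp \<zeta> (\<lambda>e. L (pf e) (ps e))"
    unfolding L_def by (intro crec_intros rel)
  moreover have "embeds_below L \<beta> 0"
  proof -
    have "(\<beta>, r) \<in> ordIso" using r by (rule ordIso_symmetric)
    then obtain h where "iso \<beta> r h" unfolding ordIso_def by blast
    then have h: "bij_betw h (Field \<beta>) (Field r)"
      "\<And>u v. u \<in> Field \<beta> \<Longrightarrow> v \<in> Field \<beta> \<Longrightarrow> (u, v) \<in> \<beta> \<longleftrightarrow> (h u, h v) \<in> r"
      unfolding iso_iff2 by blast+
    have "L (Suc (h u)) (Suc (h v))" if uv: "(u, v) \<in> \<beta>" "u \<noteq> v" for u v
    proof -
      have "u \<in> Field \<beta>" "v \<in> Field \<beta>" using uv by (auto simp: Field_def)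
      with uv h have "(h u, h v) \<in> r" "h u \<noteq> h v" by (auto simp: bij_betw_def inj_on_def)
      then show ?thesis by (simp add: L_def)
    qed
    then show ?thesis
      unfolding embeds_below_def by (intro exI[of _ "\<lambda>u. Suc (h u)"]) (simp add: L_def)
  qed
  ultimately show thesis by (rule that)
qed

theorem theorem2:
  fixes \<zeta> :: "nat \<Rightarrow> nat"
    and PG :: "'g::topological_group_add presentation"
    and PX :: "'x::topological_space presentation"
    and act :: "'g \<Rightarrow> 'x \<Rightarrow> 'x"
    and x y :: 'x
    and \<omega>CK \<alpha> :: "(nat \<times> nat) set"
    and B :: "'x set"
  assumes "presented_in \<zeta> PG"
    and "presented_in \<zeta> PX"
    and "continuous_action act"
    and "hyp_fun \<zeta> (prod_pres PG PG) PG (\<lambda>(g, h). g + h)"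
    and "hyp_fun \<zeta> PG PG (\<lambda>g. - g)"
    and "hyp_fun \<zeta> (prod_pres PG PX) PX (\<lambda>(g, z). act g z)"
    and "hyp_point \<zeta> PX x"
    and "\<forall>C. invariant act C \<and> hyp_set \<zeta> PX C \<longrightarrow> (x \<in> C \<longleftrightarrow> y \<in> C)"
    and "is_omega1CK \<zeta> \<omega>CK"
    and "Field \<alpha> \<noteq> {}" and "(\<alpha>, \<omega>CK) \<in> ordLeq"
    and "invariant act B" and "borel_rank \<alpha> B"
  shows "x \<in> B \<longleftrightarrow> y \<in> B"
proof -
  interpret presented_action \<zeta> PG PX act
    using assms(1-3) by (simp add: presented_action_def presented_def presented_action_axioms_def)
  have sim: "sim L b x y" if "wfP L" "crecp \<zeta> (\<lambda>e. L (pf e) (ps e))" for L b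
    using assms(8) invariant_sim[of L b x] hyp_set_sim[OF assms(6,7) that] sim_refl[OF that(1)] by blast
  have "crecp \<zeta> (\<lambda>e. False)" using crecp_eq[OF crec_const[of _ 0] crec_const[of _ 1]] by simp
  \<comment> \<open>The empty relation is well-founded and recursive and leaves just the base
    clause, enough for open sets.\<close>
  then have sim_base: "sim (\<lambda>_ _. False) 0 x y" by (intro sim) (simp_all add: wfp_def)
  have sim_less: "\<exists>L b. embeds_below L \<beta> b \<and> sim L b x y" if "(\<beta>, \<alpha>) \<in> ordLess" for \<beta>
  proof -
    \<comment> \<open>Only ranks strictly below \<alpha> must be recursive, so \<alpha> may equal
      the bound.\<close>
    have "(\<beta>, \<omega>CK) \<in> ordLess" using that assms(11) by (rule ordLess_ordLeq_trans)
    then have "recursive_ordinal \<zeta> \<beta>" using assms(9) by (simp add: is_omega1CK_def)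
    then show ?thesis by (metis recursive_ordinal_embeds_below sim)
  qed
  have Sigma0: "x \<in> S \<longleftrightarrow> y \<in> S" if "Sigma0 \<alpha> S" "invariant act S" for S
  proof
    show "x \<in> S \<Longrightarrow> y \<in> S"
      by (rule sim_Sigma0[OF that]) (use sim_base sim_less in blast)+
    show "y \<in> S \<Longrightarrow> x \<in> S"
      by (rule sim_Sigma0[OF that]) (use sim_base sim_less sim_sym in blast)+
  qed
  have "invariant act (- B)"
    by (rule invariantI) (use invariant_iff[OF assms(12)] in simp)
  then show ?thesis
    using assms(12,13) Sigma0[of B] Sigma0[of "- B"] unfolding borel_rank_def Pi0_def by blast
qed

end
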